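(* Consider the stochastic energy exchange model, the functions $V,W$, the constant $M_0$, the set $G$ and the $G$-induced chain $\hat{\mathbf{E}}_n$ with kernel $\hat P$ described in the context. There exist constants $M_1>1$ and $\delta>0$ such that $$\hat PW(\mathbf{E})\le(1-\delta)W(\mathbf{E})$$ for every $\mathbf{E}\in G$ with $W(\mathbf{E})>M_1$.
   Context: Fix $N\ge1$, $T_L,T_R>0$, a sufficiently large $K$ ($K\gg T_L,T_R$) and $R(a,b)=\min\{K,\sqrt{\min(a,b)}\}$. The stochastic energy exchange model is the Markov jump process $\mathbf{E}_t=(E_1(t),\dots,E_N(t))$ on $\mathbb{R}^N_+$: for $i=1,\dots,N-1$ a clock of rate $R(E_i,E_{i+1})$ on sites $i,i+1$; when it rings $(E_i,E_{i+1})\mapsto(p(E_i+E_{i+1}),(1-p)(E_i+E_{i+1}))$, $p$ uniform on $(0,1)$; a clock of rate $R(T_L,E_1)$ (resp. $R(E_N,T_R)$) with $E_1\mapsto p(E_1+X_L)$ (resp. $E_N\mapsto p(E_N+X_R)$), $X_L,X_R$ exponential with means $T_L,T_R$; all independent. $P^t$ is its transition kernel. Let $W(\mathbf{E})=\sum_{i=1}^N E_i$, $a_m=1-\frac{2^{m-1}-1}{2^N-1}$, and for small $\eta>0$, $V(\mathbf{E})=\sum_{m=1}^N\sum_{k=1}^{N-m+1}\big(\sum_{j=0}^{m-1}E_{k+j}\big)^{a_m\eta-1}$. Fix sufficiently small $\eta>0$ and $h>0$, and a constant $M_0>1$ such that $P^hV(\mathbf{E})-V(\mathbf{E})\le-c_0V(\mathbf{E})^{\alpha}$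 whenever $V(\mathbf{E})>M_0$, for some $c_0>0$, $\alpha=1-\frac{1}{2(1-\eta)}$. Let $G=\{\mathbf{E}:V(\mathbf{E})\le M_0\}$. The time-$h$ sampling chain is $\mathbf{E}_n:=\mathbf{E}_{nh}$; let $T_0=0$, $T_{n+1}=\inf\{k>T_n:\mathbf{E}_{kh}\in G\}$ and $\hat{\mathbf{E}}_n=\mathbf{E}_{T_nh}$, the $G$-induced chain, with transition kernel $\hat P$, so $\hat PW(\mathbf{E})=\mathbb{E}_{\mathbf{E}}[W(\mathbf{E}_{T_1h})]$. *)

theory Defs
  imports "HOL-Probability.Probability"
begin

text \<open>States are vectors E = (E_0,...,E_{N-1}) (0-indexed; sites 1..N of the paper
  correspond to indices 0..N-1), represented as functions nat => real; only the
  coordinates below N are used.  Observables are nonnegative functions into ennreal.\<close>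

type_synonym state = "nat \<Rightarrow> real"

definition pos_states :: "nat \<Rightarrow> state set" where
  "pos_states N = {x. \<forall>i<N. 0 < x i}"

definition rate :: "real \<Rightarrow> real \<Rightarrow> real \<Rightarrow> real" where
  "rate K a b = min K (sqrt (min a b))"

definition Wfun :: "nat \<Rightarrow> state \<Rightarrow> real" where
  "Wfun N x = (\<Sum>i<N. x i)"

definition aexp :: "nat \<Rightarrow> nat \<Rightarrow> real" where
  "aexp N m = 1 - (2 ^ (m - 1) - 1) / (2 ^ N - 1)"

definition Vfun :: "nat \<Rightarrow> real \<Rightarrow> state \<Rightarrow> real" where
  "Vfun N \<eta> x = (\<Sum>m\<in>{1..N}. \<Sum>k<N - m + 1. (\<Sum>j<m. x (k + j)) powr (aexp N m * \<eta> - 1))"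

text \<open>Total jump rate in state x, and the uniformization constant (N+1)K, which bounds it.\<close>

definition total_rate :: "nat \<Rightarrow> real \<Rightarrow> real \<Rightarrow> real \<Rightarrow> state \<Rightarrow> real" where
  "total_rate N K TL TR x =
     (\<Sum>i<N - 1. rate K (x i) (x (Suc i))) + rate K TL (x 0) + rate K (x (N - 1)) TR"

definition unif_rate :: "nat \<Rightarrow> real \<Rightarrow> real" where
  "unif_rate N K = real (N + 1) * K"

definition jump_part ::
  "nat \<Rightarrow> real \<Rightarrow> real \<Rightarrow> real \<Rightarrow> (state \<Rightarrow> ennreal) \<Rightarrow> state \<Rightarrow> ennreal" where
  "jump_part N K TL TR f x =
     (\<Sum>i<N - 1. ennreal (rate K (x i) (x (Suc i))) *
        (\<integral>\<^sup>+ p\<in>{0<..<1}. f (x(i := p * (x i + x (Suc i)),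
                               Suc i := (1 - p) * (x i + x (Suc i)))) \<partial>lborel))
   + ennreal (rate K TL (x 0)) *
        (\<integral>\<^sup>+ p\<in>{0<..<1}. (\<integral>\<^sup>+ X. ennreal (exponential_density (1 / TL) X) *
              f (x(0 := p * (x 0 + X))) \<partial>lborel) \<partial>lborel)
   + ennreal (rate K (x (N - 1)) TR) *
        (\<integral>\<^sup>+ p\<in>{0<..<1}. (\<integral>\<^sup>+ X. ennreal (exponential_density (1 / TR) X) *
              f (x(N - 1 := p * (x (N - 1) + X))) \<partial>lborel) \<partial>lborel)"

definition Qop :: "nat \<Rightarrow> real \<Rightarrow> real \<Rightarrow> real \<Rightarrow> (state \<Rightarrow> ennreal) \<Rightarrow> state \<Rightarrow> ennreal" where
  "Qop N K TL TR f x =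
     ennreal (1 / unif_rate N K) * jump_part N K TL TR f x
   + ennreal (1 - total_rate N K TL TR x / unif_rate N K) * f x"

text \<open>Transition kernel P^t of the Markov jump process (bounded rates, so given by
  uniformization): P^t f = sum_n e^{-lambda t} (lambda t)^n / n! Q^n f.\<close>

definition Pt :: "nat \<Rightarrow> real \<Rightarrow> real \<Rightarrow> real \<Rightarrow> real \<Rightarrow> (state \<Rightarrow> ennreal) \<Rightarrow> state \<Rightarrow> ennreal" where
  "Pt N K TL TR t f x =
     (\<Sum>n. ennreal (exp (- unif_rate N K * t) * (unif_rate N K * t) ^ n / fact n) *
           ((Qop N K TL TR ^^ n) f) x)"

text \<open>G-induced chain of the time-h sampling chain:
  hatP f x = E_x[f(E_{T_1 h})] = sum_{k>=1} E_x[1{E_h,..,E_{(k-1)h} notin G, E_{kh} in G} f(E_{kh})].\<close>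

definition hatP :: "nat \<Rightarrow> real \<Rightarrow> real \<Rightarrow> real \<Rightarrow> real \<Rightarrow> state set \<Rightarrow>
    (state \<Rightarrow> ennreal) \<Rightarrow> state \<Rightarrow> ennreal" where
  "hatP N K TL TR h G f x =
     (\<Sum>k. (((\<lambda>g y. Pt N K TL TR h (\<lambda>z. if z \<in> G then 0 else g z) y) ^^ k)
            (Pt N K TL TR h (\<lambda>z. if z \<in> G then f z else 0))) x)"

end

theory Submission
  imports Defs
begin

text \<open>
  A jump never raises \<open>V\<close> by more than a factor that is integrable in \<open>p\<close>, so \<open>P\<^sup>h V\<close> is bounded
  on \<open>G\<close>; and \<open>P\<^sup>h W \<le> W + C\<close>, because only the baths add energy. Hence the drift hypothesis makes
  \<open>u = W + B V\<close> superharmonic off \<open>G\<close> for large \<open>B\<close>, and the excursion sum defining the induced chain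
  gives \<open>hatP W \<le> P\<^sup>h u \<le> P\<^sup>h W + const\<close> on \<open>G\<close>. On \<open>G\<close> all energies, and hence all rates, are bounded
  below, so with positive probability the first \<open>N\<close> jumps carry a fixed fraction of the total energy
  to the left bath. This gives \<open>P\<^sup>h W \<le> (1 - 2 \<delta>) W + const\<close> there, and large \<open>W\<close> absorbs the constant.
\<close>

section \<open>Positive operators\<close>

text \<open>An abstract stand-in for a transition kernel. Linearity is demanded on measurable
  functions, where integrals are additive; monotonicity is demanded for all functions, compared on
  \<open>S\<close> only. Thus values off \<open>S\<close> never influence values on
  \<open>S\<close>, which encodes that the chain cannot leave \<open>S\<close>.\<close>

definition positive_operator ::
  "'a measure \<Rightarrow> 'a set \<Rightarrow> (('a \<Rightarrow> ennreal) \<Rightarrow> 'a \<Rightarrow> ennreal) \<Rightarrow> bool" where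
  "positive_operator M S A \<longleftrightarrow>
     (\<forall>f\<in>borel_measurable M. A f \<in> borel_measurable M) \<and>
     (\<forall>f\<in>borel_measurable M. \<forall>g\<in>borel_measurable M. \<forall>x\<in>S.
        A (\<lambda>y. f y + g y) x = A f x + A g x) \<and>
     (\<forall>f\<in>borel_measurable M. \<forall>c. \<forall>x\<in>S. A (\<lambda>y. c * f y) x = c * A f x) \<and>
     (\<forall>f g. (\<forall>y\<in>S. f y \<le> g y) \<longrightarrow> (\<forall>x\<in>S. A f x \<le> A g x))"

lemma positive_operatorI:
  assumes "\<And>f. f \<in> borel_measurable M \<Longrightarrow> A f \<in> borel_measurable M"
    and "\<And>f g x. f \<in> borel_measurable M \<Longrightarrow> g \<in> borel_measurable M \<Longrightarrow> x \<in> S \<Longrightarrow>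
           A (\<lambda>y. f y + g y) x = A f x + A g x"
    and "\<And>f c x. f \<in> borel_measurable M \<Longrightarrow> x \<in> S \<Longrightarrow> A (\<lambda>y. c * f y) x = c * A f x"
    and "\<And>f g x. (\<And>y. y \<in> S \<Longrightarrow> f y \<le> g y) \<Longrightarrow> x \<in> S \<Longrightarrow> A f x \<le> A g x"
  shows "positive_operator M S A"
  using assms unfolding positive_operator_def by simp

lemma positive_operatorD:
  assumes "positive_operator M S A"
  shows positive_operator_measurable: "\<And>f. f \<in> borel_measurable M \<Longrightarrow> A f \<in> borel_measurable M"
    and positive_operator_add: "\<And>f g x. f \<in> borel_measurable M \<Longrightarrow> g \<in> borel_measurable M \<Longrightarrow>
           x \<in> S \<Longrightarrow> A (\<lambda>y. f y + g y) x = A f x + A g x"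
    and positive_operator_cmult: "\<And>f c x. f \<in> borel_measurable M \<Longrightarrow> x \<in> S \<Longrightarrow>
           A (\<lambda>y. c * f y) x = c * A f x"
    and positive_operator_mono: "\<And>f g x. (\<And>y. y \<in> S \<Longrightarrow> f y \<le> g y) \<Longrightarrow> x \<in> S \<Longrightarrow> A f x \<le> A g x"
  using assms unfolding positive_operator_def by simp_all

lemma positive_operator_cong:
  assumes "positive_operator M S A" "\<And>y. y \<in> S \<Longrightarrow> f y = g y" "x \<in> S"
  shows "A f x = A g x"
  using positive_operator_mono[OF assms(1), of f g x] positive_operator_mono[OF assms(1), of g f x] assms(2,3)
  by (simp add: antisym)

lemma positive_operator_id: "positive_operator M S (\<lambda>f. f)"
  by (rule positive_operatorI) auto

lemma positive_operator_comp:
  assumes A: "positive_operator M S A" and B: "positive_operator M S B"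
  shows "positive_operator M S (\<lambda>f. A (B f))"
proof (rule positive_operatorI)
  fix f g :: "'a \<Rightarrow> ennreal" and x assume fg: "f \<in> borel_measurable M" "g \<in> borel_measurable M" "x \<in> S"
  have "A (B (\<lambda>y. f y + g y)) x = A (\<lambda>y. B f y + B g y) x"
    by (rule positive_operator_cong[OF A]) (use fg positive_operator_add[OF B] in auto)
  then show "A (B (\<lambda>y. f y + g y)) x = A (B f) x + A (B g) x"
    using fg positive_operatorD[OF A] positive_operatorD[OF B] by simp
next
  fix f :: "'a \<Rightarrow> ennreal" and x c assume fg: "f \<in> borel_measurable M" "x \<in> S"
  have "A (B (\<lambda>y. c * f y)) x = A (\<lambda>y. c * B f y) x"
    by (rule positive_operator_cong[OF A]) (use fg positive_operator_cmult[OF B] in auto)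
  then show "A (B (\<lambda>y. c * f y)) x = c * A (B f) x"
    using fg positive_operatorD[OF A] positive_operatorD[OF B] by simp
qed (use positive_operatorD[OF A] positive_operatorD[OF B] in auto)

lemma positive_operator_funpow:
  assumes "positive_operator M S A"
  shows "positive_operator M S (A ^^ n)"
  by (induction n) (simp_all add: positive_operator_id positive_operator_comp[OF assms] id_def o_def)

lemma positive_operator_plus:
  assumes A: "positive_operator M S A" and B: "positive_operator M S B"
  shows "positive_operator M S (\<lambda>f x. A f x + B f x)"
  by (rule positive_operatorI)
    (use positive_operatorD[OF A] positive_operatorD[OF B] in
      \<open>auto simp: distrib_left add_ac intro!: add_mono\<close>)

lemma positive_operator_scale:
  assumes A: "positive_operator M S A" and r: "r \<in> borel_measurable M"
  shows "positive_operator M S (\<lambda>f x. r x * A f x)"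
  by (rule positive_operatorI)
    (use positive_operatorD[OF A] r in \<open>auto simp: distrib_left mult.left_commute intro!: mult_left_mono\<close>)

lemma positive_operator_sum:
  assumes "\<And>i. i \<in> I \<Longrightarrow> positive_operator M S (A i)"
  shows "positive_operator M S (\<lambda>f x. \<Sum>i\<in>I. A i f x)"
  by (rule positive_operatorI)
    (use positive_operatorD[OF assms] in \<open>auto simp: sum.distrib sum_distrib_left intro!: sum_mono sum.cong\<close>)

lemma positive_operator_suminf:
  fixes A :: "nat \<Rightarrow> ('a \<Rightarrow> ennreal) \<Rightarrow> 'a \<Rightarrow> ennreal"
  assumes A: "\<And>i. positive_operator M S (A i)"
  shows "positive_operator M S (\<lambda>f x. \<Sum>i. A i f x)"
proof (rule positive_operatorI)
  fix f g :: "'a \<Rightarrow> ennreal" and x assume fg: "f \<in> borel_measurable M" "g \<in> borel_measurable M" "x \<in> S"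
  then show "(\<Sum>i. A i (\<lambda>y. f y + g y) x) = (\<Sum>i. A i f x) + (\<Sum>i. A i g x)"
    using positive_operator_add[OF A] by (simp add: suminf_add)
next
  fix f :: "'a \<Rightarrow> ennreal" assume "f \<in> borel_measurable M"
  then show "(\<lambda>x. \<Sum>i. A i f x) \<in> borel_measurable M"
    using positive_operator_measurable[OF A] by measurable
next
  fix f :: "'a \<Rightarrow> ennreal" and x c assume "f \<in> borel_measurable M" "x \<in> S"
  then show "(\<Sum>i. A i (\<lambda>y. c * f y) x) = c * (\<Sum>i. A i f x)"
    using positive_operator_cmult[OF A] by simp
next
  fix f g :: "'a \<Rightarrow> ennreal" and x assume "\<And>y. y \<in> S \<Longrightarrow> f y \<le> g y" "x \<in> S"
  then show "(\<Sum>i. A i f x) \<le> (\<Sum>i. A i g x)"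
    using positive_operator_mono[OF A] by (intro suminf_le summableI) auto
qed

text \<open>This is the chain killed on entering \<open>G\<close>; its powers are the terms of the
  excursion sum in \<open>hatP\<close>.\<close>

lemma positive_operator_restrict:
  assumes A: "positive_operator M S A" and G: "G \<in> sets M"
  shows "positive_operator M S (\<lambda>f. A (\<lambda>z. if z \<in> G then 0 else f z))"
proof -
  have "positive_operator M S (\<lambda>f z. if z \<in> G then 0 :: ennreal else f z)"
  proof (rule positive_operatorI)
    fix f :: "'a \<Rightarrow> ennreal" assume "f \<in> borel_measurable M"
    then show "(\<lambda>z. if z \<in> G then 0 else f z) \<in> borel_measurable M"
      using G by measurable
  qed auto
  from positive_operator_comp[OF A this] show ?thesis .
qed

text \<open>One step splits into the part that lands in \<open>G\<close>, where \<open>f\<close> is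
  collected, and the part that continues the excursion. Superharmonicity off \<open>G\<close> makes
  this splitting iterable, so the sum over all excursion lengths telescopes below
  \<open>P u\<close>.\<close>

lemma killed_sum_le_superharmonic:
  fixes f u :: "'a \<Rightarrow> ennreal"
  assumes A: "positive_operator M S P" and G: "G \<in> sets M"
    and f[measurable]: "f \<in> borel_measurable M" and u[measurable]: "u \<in> borel_measurable M"
    and fu: "\<And>y. y \<in> S \<Longrightarrow> y \<in> G \<Longrightarrow> f y \<le> u y"
    and super: "\<And>y. y \<in> S \<Longrightarrow> y \<notin> G \<Longrightarrow> P u y \<le> u y"
    and x: "x \<in> S"
  shows "(\<Sum>k. ((\<lambda>g. P (\<lambda>z. if z \<in> G then 0 else g z)) ^^ k) (P (\<lambda>z. if z \<in> G then f z else 0)) x)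
           \<le> P u x"
proof -
  note [measurable] = G positive_operator_measurable[OF A]
  define A' where "A' = (\<lambda>g. P (\<lambda>z. if z \<in> G then 0 else g z))"
  define b where "b = P (\<lambda>z. if z \<in> G then f z else 0)"
  have A': "positive_operator M S A'"
    unfolding A'_def by (rule positive_operator_restrict[OF A G])
  have [measurable]: "b \<in> borel_measurable M" "P u \<in> borel_measurable M"
    unfolding b_def by measurable
  have mA[measurable]: "A' (P u) \<in> borel_measurable M"
    by (rule positive_operator_measurable[OF A']) measurable
  \<comment> \<open>On \<open>G\<close> the summand is \<open>f \<le> u\<close>, off
    \<open>G\<close> it is \<open>P u \<le> u\<close>; in both cases it lies below \<open>u\<close>
    before the outer \<open>P\<close> is applied.\<close>
  have step: "b y + A' (P u) y \<le> P u y" if y: "y \<in> S" for y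
  proof -
    have "b y + A' (P u) y = P (\<lambda>z. (if z \<in> G then f z else 0) + (if z \<in> G then 0 else P u z)) y"
      unfolding b_def A'_def by (rule positive_operator_add[OF A, symmetric]) (use y in measurable)
    also have "\<dots> \<le> P u y"
      by (rule positive_operator_mono[OF A _ y]) (use fu super in auto)
    finally show ?thesis .
  qed
  have "(\<Sum>k<n. (A' ^^ k) b x) + (A' ^^ n) (P u) x \<le> P u x" for n
  proof (induction n)
    case (Suc n)
    note An = positive_operator_funpow[OF A', of n]
    have "(A' ^^ n) b x + (A' ^^ Suc n) (P u) x = (A' ^^ n) (\<lambda>y. b y + A' (P u) y) x"
      by (subst positive_operator_add[OF An]) (use x in \<open>auto simp: funpow_Suc_right simp del: funpow.simps\<close>)
    also have "\<dots> \<le> (A' ^^ n) (P u) x"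
      by (rule positive_operator_mono[OF An step x])
    finally have "(\<Sum>k<Suc n. (A' ^^ k) b x) + (A' ^^ Suc n) (P u) x
        \<le> (\<Sum>k<n. (A' ^^ k) b x) + (A' ^^ n) (P u) x"
      by (simp add: add.assoc add_left_mono del: funpow.simps)
    also note Suc
    finally show ?case .
  qed simp
  \<comment> \<open>The remainder \<open>(A' ^^ n) (P u) x\<close> is nonnegative, so dropping it
    bounds every partial sum.\<close>
  then have "(\<Sum>k<n. (A' ^^ k) b x) \<le> P u x" for n
    by (meson add_increasing2 order_trans zero_le order_refl)
  then show ?thesis
    unfolding A'_def[symmetric] b_def[symmetric] by (intro suminf_le_const summableI)
qed

section \<open>Positive operators from substitutions and mixtures\<close>

lemma positive_operator_subst:
  assumes "T \<in> measurable M M" "\<And>x. x \<in> S \<Longrightarrow> T x \<in> S"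
  shows "positive_operator M S (\<lambda>f x. f (T x))"
  by (rule positive_operatorI) (use assms in auto)

text \<open>Joint measurability of the integrand makes the integral measurable in the starting
  point. Positivity of \<open>B s\<close> is asked only where \<open>l s\<close> is nonzero: for
  other parameters, such as \<open>p\<close> outside the unit interval or \<open>X < 0\<close>, a
  jump may leave the positive orthant.\<close>

lemma positive_operator_mixture:
  fixes B :: "'s \<Rightarrow> ('a \<Rightarrow> ennreal) \<Rightarrow> 'a \<Rightarrow> ennreal"
  assumes L: "sigma_finite_measure L" and l[measurable]: "l \<in> borel_measurable L"
    and B: "\<And>s. l s \<noteq> 0 \<Longrightarrow> positive_operator M S (B s)"
    and Bm: "\<And>f. f \<in> borel_measurable M \<Longrightarrow> (\<lambda>(x, s). B s f x) \<in> borel_measurable (M \<Otimes>\<^sub>M L)"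
    and S: "S \<subseteq> space M"
  shows "positive_operator M S (\<lambda>f x. \<integral>\<^sup>+s. l s * B s f x \<partial>L)"
proof (rule positive_operatorI)
  interpret sigma_finite_measure L by (rule L)
  fix f :: "'a \<Rightarrow> ennreal" assume [measurable]: "f \<in> borel_measurable M"
  note [measurable] = Bm[of f]
  show "(\<lambda>x. \<integral>\<^sup>+s. l s * B s f x \<partial>L) \<in> borel_measurable M"
    by measurable
  have slice: "(\<lambda>s. B s f x) \<in> borel_measurable L"
    if "f \<in> borel_measurable M" "x \<in> S" for f x
  proof -
    have "(\<lambda>s. case (x, s) of (x, s) \<Rightarrow> B s f x) \<in> borel_measurable L"
      by (rule measurable_compose[OF measurable_Pair1' Bm]) (use that S in auto)
    then show ?thesis by simp
  qed
  fix c x assume x: "x \<in> S"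
  have "(\<integral>\<^sup>+s. l s * B s (\<lambda>y. c * f y) x \<partial>L) = (\<integral>\<^sup>+s. c * (l s * B s f x) \<partial>L)"
  proof (rule nn_integral_cong)
    fix s show "l s * B s (\<lambda>y. c * f y) x = c * (l s * B s f x)"
      by (cases "l s = 0") (use x in \<open>auto simp: positive_operator_cmult[OF B] mult.left_commute\<close>)
  qed
  then show "(\<integral>\<^sup>+s. l s * B s (\<lambda>y. c * f y) x \<partial>L) = c * (\<integral>\<^sup>+s. l s * B s f x \<partial>L)"
    using slice[of f x] x by (simp add: nn_integral_cmult)
  fix g :: "'a \<Rightarrow> ennreal" assume [measurable]: "g \<in> borel_measurable M"
  have "(\<integral>\<^sup>+s. l s * B s (\<lambda>y. f y + g y) x \<partial>L) = (\<integral>\<^sup>+s. l s * B s f x + l s * B s g x \<partial>L)"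
  proof (rule nn_integral_cong)
    fix s show "l s * B s (\<lambda>y. f y + g y) x = l s * B s f x + l s * B s g x"
      by (cases "l s = 0") (use x in \<open>auto simp: positive_operator_add[OF B] distrib_left\<close>)
  qed
  then show "(\<integral>\<^sup>+s. l s * B s (\<lambda>y. f y + g y) x \<partial>L) = (\<integral>\<^sup>+s. l s * B s f x \<partial>L) + (\<integral>\<^sup>+s. l s * B s g x \<partial>L)"
    using slice[of f x] slice[of g x] x by (simp add: nn_integral_add)
next
  fix f g :: "'a \<Rightarrow> ennreal" and x assume fg: "\<And>y. y \<in> S \<Longrightarrow> f y \<le> g y" and x: "x \<in> S"
  show "(\<integral>\<^sup>+s. l s * B s f x \<partial>L) \<le> (\<integral>\<^sup>+s. l s * B s g x \<partial>L)"
  proof (rule nn_integral_mono)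
    fix s show "l s * B s f x \<le> l s * B s g x"
      by (cases "l s = 0") (use fg x in \<open>auto intro!: mult_left_mono positive_operator_mono[OF B]\<close>)
  qed
qed

section \<open>The jump operators\<close>

text \<open>States are total functions on \<open>nat\<close>, so the product runs over all indices
  and its space is the whole type. Positivity of the \<open>N\<close> sites enters through the set
  \<open>pos_states N\<close> instead.\<close>

abbreviation state_algebra :: "state measure" where
  "state_algebra \<equiv> PiM UNIV (\<lambda>_. borel)"

definition exchange_state :: "nat \<Rightarrow> state \<Rightarrow> real \<Rightarrow> state" where
  "exchange_state i x p = x(i := p * (x i + x (Suc i)), Suc i := (1 - p) * (x i + x (Suc i)))"

definition bath_state :: "nat \<Rightarrow> state \<Rightarrow> real \<Rightarrow> real \<Rightarrow> state" where
  "bath_state i x p X = x(i := p * (x i + X))"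

definition exchange_op :: "nat \<Rightarrow> (state \<Rightarrow> ennreal) \<Rightarrow> state \<Rightarrow> ennreal" where
  "exchange_op i f x = (\<integral>\<^sup>+p\<in>{0<..<1}. f (exchange_state i x p) \<partial>lborel)"

definition bath_op :: "nat \<Rightarrow> real \<Rightarrow> (state \<Rightarrow> ennreal) \<Rightarrow> state \<Rightarrow> ennreal" where
  "bath_op i T f x = (\<integral>\<^sup>+p\<in>{0<..<1}. (\<integral>\<^sup>+X. ennreal (exponential_density (1 / T) X) *
     f (bath_state i x p X) \<partial>lborel) \<partial>lborel)"

lemma jump_part_eq:
  "jump_part N K TL TR f x =
     (\<Sum>i<N - 1. ennreal (rate K (x i) (x (Suc i))) * exchange_op i f x)
     + ennreal (rate K TL (x 0)) * bath_op 0 TL f x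
     + ennreal (rate K (x (N - 1)) TR) * bath_op (N - 1) TR f x"
  unfolding jump_part_def exchange_op_def bath_op_def exchange_state_def bath_state_def ..

section \<open>Measurability, and jumps that preserve positive states\<close>

lemma measurable_coordinate [measurable]: "(\<lambda>x. x i) \<in> borel_measurable state_algebra"
  by (rule measurable_component_singleton) simp

lemma measurable_rate [measurable]:
  assumes "f \<in> borel_measurable M" "g \<in> borel_measurable M"
  shows "(\<lambda>x. rate K (f x) (g x)) \<in> borel_measurable M"
  unfolding rate_def using assms by measurable

lemma measurable_Wfun [measurable]: "Wfun N \<in> borel_measurable state_algebra"
  unfolding Wfun_def[abs_def] by measurable

lemma measurable_Vfun [measurable]: "Vfun N \<eta> \<in> borel_measurable state_algebra"
  unfolding Vfun_def[abs_def] by measurable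

lemma sets_pos_states [measurable]: "pos_states N \<in> sets state_algebra"
proof -
  have "{x \<in> space state_algebra. \<forall>i<N. 0 < x i} \<in> sets state_algebra"
    by measurable
  then show ?thesis by (simp add: pos_states_def space_PiM)
qed

lemma exchange_state_pos:
  "x \<in> pos_states N \<Longrightarrow> i < N - 1 \<Longrightarrow> 0 < p \<Longrightarrow> p < 1 \<Longrightarrow> exchange_state i x p \<in> pos_states N"
  by (auto simp: pos_states_def exchange_state_def add_pos_pos)

lemma bath_state_pos:
  "x \<in> pos_states N \<Longrightarrow> i < N \<Longrightarrow> 0 < p \<Longrightarrow> 0 \<le> X \<Longrightarrow> bath_state i x p X \<in> pos_states N"
  by (auto simp: pos_states_def bath_state_def add_pos_nonneg)

lemma measurable_state_upd:
  assumes "f \<in> measurable M state_algebra" "g \<in> borel_measurable M"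
  shows "(\<lambda>x. (f x)(i := g x)) \<in> measurable M state_algebra"
  by (rule measurable_fun_upd[where J=UNIV]) (use assms in auto)

lemma measurable_state_component:
  assumes "f \<in> measurable M state_algebra"
  shows "(\<lambda>x. f x i) \<in> borel_measurable M"
  using measurable_compose[OF assms measurable_coordinate] .

lemma measurable_exchange_state [measurable (raw)]:
  assumes f: "f \<in> measurable M state_algebra" and g: "g \<in> borel_measurable M"
  shows "(\<lambda>x. exchange_state i (f x) (g x)) \<in> measurable M state_algebra"
proof -
  note [measurable] = g measurable_state_component[OF f]
  show ?thesis
    unfolding exchange_state_def
    by (rule measurable_state_upd[OF measurable_state_upd[OF f]]) measurable
qed

lemma measurable_bath_state [measurable (raw)]:
  assumes f: "f \<in> measurable M state_algebra" and g: "g \<in> borel_measurable M" "h \<in> borel_measurable M"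
  shows "(\<lambda>x. bath_state i (f x) (g x) (h x)) \<in> measurable M state_algebra"
proof -
  note [measurable] = g measurable_state_component[OF f]
  show ?thesis
    unfolding bath_state_def by (rule measurable_state_upd[OF f]) measurable
qed

lemma pos_states_subset_space: "pos_states N \<subseteq> space state_algebra"
  by (simp add: space_PiM)

lemma positive_operator_exchange:
  assumes i: "i < N - 1"
  shows "positive_operator state_algebra (pos_states N) (exchange_op i)"
proof -
  have "positive_operator state_algebra (pos_states N)
      (\<lambda>f x. \<integral>\<^sup>+p. indicator {0<..<1::real} p * f (exchange_state i x p) \<partial>lborel)"
  proof (rule positive_operator_mixture[OF sigma_finite_lborel])
    fix p :: real assume "indicator {0<..<1} p \<noteq> (0::ennreal)"
    then show "positive_operator state_algebra (pos_states N) (\<lambda>f x. f (exchange_state i x p))"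
      using i by (intro positive_operator_subst) (auto intro!: exchange_state_pos split: split_indicator_asm)
  qed (simp_all add: pos_states_subset_space)
  then show ?thesis
    unfolding exchange_op_def[abs_def] by (simp add: mult.commute)
qed

lemma positive_operator_bath:
  assumes i: "i < N"
  shows "positive_operator state_algebra (pos_states N) (bath_op i T)"
proof -
  have "positive_operator state_algebra (pos_states N)
      (\<lambda>f x. \<integral>\<^sup>+p. indicator {0<..<1::real} p *
        (\<integral>\<^sup>+X. ennreal (exponential_density (1 / T) X) * f (bath_state i x p X) \<partial>lborel) \<partial>lborel)"
  proof (rule positive_operator_mixture[OF sigma_finite_lborel])
    fix p :: real assume p: "indicator {0<..<1} p \<noteq> (0::ennreal)"
    show "positive_operator state_algebra (pos_states N)
       (\<lambda>f x. \<integral>\<^sup>+X. ennreal (exponential_density (1 / T) X) * f (bath_state i x p X) \<partial>lborel)"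
    proof (rule positive_operator_mixture[OF sigma_finite_lborel])
      \<comment> \<open>The density vanishes for negative \<open>X\<close>, so positivity has to be
        preserved only for nonnegative deposits.\<close>
      fix X assume "ennreal (exponential_density (1 / T) X) \<noteq> 0"
      then have "0 \<le> X" by (auto simp: exponential_density_def split: if_splits)
      then show "positive_operator state_algebra (pos_states N) (\<lambda>f x. f (bath_state i x p X))"
        using p by (intro positive_operator_subst) (auto intro!: bath_state_pos i split: split_indicator_asm)
    qed (simp_all add: pos_states_subset_space)
  qed (simp_all add: pos_states_subset_space)
  then show ?thesis
    unfolding bath_op_def[abs_def] by (simp add: mult.commute[of _ "indicator _ _"])
qed

lemma positive_operator_jump_part:
  assumes "N \<ge> 1"
  shows "positive_operator state_algebra (pos_states N) (jump_part N K TL TR)"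
proof -
  have "positive_operator state_algebra (pos_states N) (\<lambda>f x.
     (\<Sum>i<N - 1. ennreal (rate K (x i) (x (Suc i))) * exchange_op i f x)
     + ennreal (rate K TL (x 0)) * bath_op 0 TL f x
     + ennreal (rate K (x (N - 1)) TR) * bath_op (N - 1) TR f x)"
    using assms
    by (intro positive_operator_plus positive_operator_sum positive_operator_scale
        positive_operator_exchange positive_operator_bath) auto
  then show ?thesis
    by (simp add: jump_part_eq[abs_def])
qed

text \<open>The coefficients are cast into \<open>ennreal\<close> and are thus nonnegative by
  construction; what has to be checked is their measurability.\<close>

lemma positive_operator_Qop:
  assumes "N \<ge> 1"
  shows "positive_operator state_algebra (pos_states N) (Qop N K TL TR)"
proof -
  have "positive_operator state_algebra (pos_states N)
      (\<lambda>f x. ennreal (1 - total_rate N K TL TR x / unif_rate N K) * f x)"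
    by (rule positive_operator_scale[OF positive_operator_id]) (unfold total_rate_def, measurable)
  then show ?thesis
    unfolding Qop_def[abs_def]
    by (rule positive_operator_plus[OF positive_operator_scale[OF positive_operator_jump_part[OF assms]], rotated])
      simp
qed

lemma positive_operator_Pt:
  assumes "N \<ge> 1"
  shows "positive_operator state_algebra (pos_states N) (Pt N K TL TR t)"
  unfolding Pt_def[abs_def]
  by (rule positive_operator_suminf, rule positive_operator_scale,
      rule positive_operator_funpow[OF positive_operator_Qop[OF assms]]) simp

section \<open>One-jump estimates\<close>

lemma pos_statesD: "x \<in> pos_states N \<Longrightarrow> i < N \<Longrightarrow> 0 < x i"
  by (simp add: pos_states_def)

lemma Wfun_nonneg: "x \<in> pos_states N \<Longrightarrow> 0 \<le> Wfun N x"
  unfolding Wfun_def by (intro sum_nonneg) (auto simp: pos_states_def less_imp_le)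

lemma coordinate_le_Wfun: "x \<in> pos_states N \<Longrightarrow> i < N \<Longrightarrow> x i \<le> Wfun N x"
  unfolding Wfun_def by (rule member_le_sum) (auto simp: pos_states_def less_imp_le)

text \<open>The shares \<open>p\<close> and \<open>1 - p\<close> add up to one, and no other site is
  touched.\<close>

lemma Wfun_exchange:
  assumes "i < N - 1"
  shows "Wfun N (exchange_state i x p) = Wfun N x"
proof -
  have split: "Wfun N y = y i + (y (Suc i) + (\<Sum>j\<in>{..<N} - {i} - {Suc i}. y j))" for y
    unfolding Wfun_def using assms
    by (subst sum.remove[of _ i], simp_all, subst sum.remove[of _ "Suc i"]) auto
  have "(\<Sum>j\<in>{..<N} - {i} - {Suc i}. exchange_state i x p j) = (\<Sum>j\<in>{..<N} - {i} - {Suc i}. x j)"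
    by (rule sum.cong) (auto simp: exchange_state_def)
  then show ?thesis
    unfolding split by (simp add: exchange_state_def algebra_simps)
qed

lemma Wfun_bath:
  assumes "i < N"
  shows "Wfun N (bath_state i x p X) = Wfun N x - x i + p * (x i + X)"
proof -
  have split: "Wfun N y = y i + (\<Sum>j\<in>{..<N} - {i}. y j)" for y
    unfolding Wfun_def using assms by (subst sum.remove[of _ i]) auto
  have "(\<Sum>j\<in>{..<N} - {i}. bath_state i x p X j) = (\<Sum>j\<in>{..<N} - {i}. x j)"
    by (rule sum.cong) (auto simp: bath_state_def)
  then show ?thesis
    unfolding split by (simp add: bath_state_def algebra_simps)
qed

lemma nn_integral_unit_interval_const:
  "(\<integral>\<^sup>+p\<in>{0<..<1::real}. c \<partial>lborel) = c"
  by (simp add: nn_integral_cmult_indicator)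

lemma nn_integral_exponential_const:
  assumes "T > 0"
  shows "(\<integral>\<^sup>+X. ennreal (exponential_density (1 / T) X) * c \<partial>lborel) = c"
  using nn_integral_erlang_ith_moment[of "1 / T" 0 0] assms by (simp add: nn_integral_multc)

text \<open>The exponential law has mass one and mean \<open>T\<close>; these are the Erlang moments
  of order 0 and 1 at shape 0.\<close>

lemma nn_integral_exponential_affine:
  assumes T: "T > 0" and "a \<ge> 0" "p \<ge> 0"
  shows "(\<integral>\<^sup>+X. ennreal (exponential_density (1 / T) X) * ennreal (a + p * X) \<partial>lborel)
           = ennreal (a + p * T)"
proof -
  have "(\<integral>\<^sup>+X. ennreal (exponential_density (1 / T) X) * ennreal (a + p * X) \<partial>lborel)
      = (\<integral>\<^sup>+X. ennreal (exponential_density (1 / T) X) * ennreal a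
            + ennreal p * ennreal (exponential_density (1 / T) X * X ^ 1) \<partial>lborel)"
  proof (rule nn_integral_cong)
    fix X :: real
    show "ennreal (exponential_density (1 / T) X) * ennreal (a + p * X) =
       ennreal (exponential_density (1 / T) X) * ennreal a
            + ennreal p * ennreal (exponential_density (1 / T) X * X ^ 1)"
    \<comment> \<open>For \<open>X < 0\<close> the cast of \<open>a + p * X\<close> may truncate,
      but the density is zero there. Otherwise all terms are nonnegative and the casts
      split.\<close>
    proof (cases "X < 0")
      case True
      then show ?thesis by (simp add: exponential_density_def)
    next
      case False
      then show ?thesis
        using assms
        by (simp add: exponential_density_def ennreal_mult''[symmetric] ennreal_plus[symmetric]
            algebra_simps add_divide_distrib del: ennreal_plus)
    qed
  qed
  also have "\<dots> = ennreal a + ennreal p * ennreal T"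
    using nn_integral_erlang_ith_moment[of "1 / T" 0 1] T
    by (simp add: nn_integral_add nn_integral_cmult nn_integral_exponential_const)
  also have "\<dots> = ennreal (a + p * T)"
    using assms by (simp add: ennreal_mult)
  finally show ?thesis .
qed

lemma exchange_op_Wfun:
  assumes "i < N - 1"
  shows "exchange_op i (\<lambda>y. ennreal (Wfun N y)) x = ennreal (Wfun N x)"
  unfolding exchange_op_def Wfun_exchange[OF assms] by (rule nn_integral_unit_interval_const)

text \<open>Averaging over \<open>X\<close> replaces it by its mean \<open>T\<close>, and averaging
  over \<open>p\<close> gives the factor 1/2: the site keeps half of its energy and half of the
  deposit.\<close>

lemma bath_op_Wfun_le:
  assumes x: "x \<in> pos_states N" and i: "i < N" and T: "T > 0"
  shows "bath_op i T (\<lambda>y. ennreal (Wfun N y)) x \<le> ennreal (Wfun N x - x i / 2 + T / 2)"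
proof -
  let ?g = "\<lambda>p. (Wfun N x - x i) + p * (x i + T)"
  have xi: "0 < x i" "x i \<le> Wfun N x"
    using pos_statesD[OF x i] coordinate_le_Wfun[OF x i] by auto
  \<comment> \<open>The open interval is enlarged to the closed one, on which the fundamental
    theorem of calculus evaluates the affine integrand.\<close>
  have "bath_op i T (\<lambda>y. ennreal (Wfun N y)) x \<le> (\<integral>\<^sup>+p. ennreal (?g p) * indicator {0..1} p \<partial>lborel)"
    unfolding bath_op_def
  proof (rule nn_integral_mono)
    fix p :: real
    show "(\<integral>\<^sup>+X. ennreal (exponential_density (1 / T) X) * ennreal (Wfun N (bath_state i x p X)) \<partial>lborel)
         * indicator {0<..<1} p \<le> ennreal (?g p) * indicator {0..1} p"
    proof (cases "p \<in> {0<..<1}")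
      case True
      have eq: "Wfun N (bath_state i x p X) = (Wfun N x - x i + p * x i) + p * X" for X
        unfolding Wfun_bath[OF i] by (simp add: algebra_simps)
      show ?thesis
        unfolding eq using True xi T
        by (subst nn_integral_exponential_affine) (simp_all add: add_nonneg_nonneg distrib_left add.assoc)
    qed simp
  qed
  also have "\<dots> = ennreal (((Wfun N x - x i) * 1 + 1 ^ 2 / 2 * (x i + T)) - ((Wfun N x - x i) * 0 + 0 ^ 2 / 2 * (x i + T)))"
    by (rule nn_integral_FTC_Icc[where F = "\<lambda>p. (Wfun N x - x i) * p + p ^ 2 / 2 * (x i + T)"])
      (use xi T in \<open>auto intro!: derivative_eq_intros add_nonneg_nonneg\<close>)
  also have "\<dots> = ennreal (Wfun N x - x i / 2 + T / 2)"
    by (simp add: field_simps)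
  finally show ?thesis .
qed

section \<open>The function \<open>Vfun\<close> under a single jump\<close>

lemma aexp_bounds:
  assumes "m \<in> {1..N}"
  shows "1 / 2 \<le> aexp N m" "aexp N m \<le> 1"
proof -
  have "(2::real) * 2 ^ (m - 1) \<le> 2 ^ N"
    using assms by (cases m) (auto simp flip: power_Suc intro: power_increasing)
  moreover have "(1::real) \<le> 2 ^ (m - 1)" by simp
  \<comment> \<open>Read \<open>u\<close> as \<open>2 ^ (m - 1)\<close> and \<open>v\<close> as
    \<open>2 ^ N\<close>: the fraction subtracted in \<open>aexp\<close> is then at most 1/2 by
    linear arithmetic.\<close>
  moreover have "v - 1 > 0 \<and> 2 * (u - 1) \<le> v - 1" if "2 * u \<le> v" "1 \<le> u" for u v :: real
    using that by auto
  ultimately have "(2::real) ^ N - 1 > 0" "2 * ((2::real) ^ (m - 1) - 1) \<le> 2 ^ N - 1"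
    by blast+
  then show "1 / 2 \<le> aexp N m" "aexp N m \<le> 1"
    unfolding aexp_def using \<open>(1::real) \<le> 2 ^ (m - 1)\<close> by (auto simp: field_simps)
qed

lemma Vfun_nonneg: "0 \<le> Vfun N \<eta> x"
  unfolding Vfun_def by (intro sum_nonneg) auto

text \<open>Every exponent in \<open>Vfun\<close> lies in the interval from \<open>\<eta> / 2 - 1\<close> to \<open>\<eta> - 1\<close>.\<close>

lemma Vfun_le_of_scaled_le:
  assumes x: "x \<in> pos_states N" and q: "0 < q" "q \<le> 1" and \<eta>: "0 < \<eta>" "\<eta> \<le> 1"
    and y: "\<And>j. j < N \<Longrightarrow> q * x j \<le> y j"
  shows "Vfun N \<eta> y \<le> q powr (\<eta> / 2 - 1) * Vfun N \<eta> x"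
proof -
  have "(\<Sum>j<m. y (k + j)) powr (aexp N m * \<eta> - 1)
      \<le> q powr (\<eta> / 2 - 1) * (\<Sum>j<m. x (k + j)) powr (aexp N m * \<eta> - 1)"
    if m: "m \<in> {1..N}" and k: "k < N - m + 1" for m k
  proof -
    let ?e = "aexp N m * \<eta> - 1" and ?s = "\<Sum>j<m. x (k + j)"
    have idx: "k + j < N" if "j < m" for j using that m k by auto
    have s: "0 < ?s"
      by (rule sum_pos) (use m idx x in \<open>auto simp: pos_states_def lessThan_empty_iff\<close>)
    have "q * ?s \<le> (\<Sum>j<m. y (k + j))"
      unfolding sum_distrib_left by (rule sum_mono) (use idx y in auto)
    moreover have e: "?e \<le> 0" "\<eta> / 2 - 1 \<le> ?e"
      using aexp_bounds[OF m] \<eta> mult_mono[of "aexp N m" 1 \<eta> 1] mult_right_mono[of "1 / 2" "aexp N m" \<eta>]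
      by auto
    \<comment> \<open>A nonpositive exponent reverses the inequality between the sums.\<close>
    ultimately have "(\<Sum>j<m. y (k + j)) powr ?e \<le> (q * ?s) powr ?e"
      using s q by (intro powr_mono2') auto
    also have "\<dots> = q powr ?e * ?s powr ?e"
      using s q by (simp add: powr_mult)
    \<comment> \<open>As \<open>q \<le> 1\<close>, the smallest exponent gives the largest power of
      \<open>q\<close>, one factor that serves all \<open>m\<close> and \<open>k\<close>.\<close>
    also have "\<dots> \<le> q powr (\<eta> / 2 - 1) * ?s powr ?e"
      using e q by (intro mult_right_mono powr_mono') auto
    finally show ?thesis .
  qed
  then show ?thesis
    unfolding Vfun_def sum_distrib_left by (intro sum_mono) auto
qed

text \<open>After a jump with parameter \<open>p\<close> every site keeps at least the fraction
  \<open>min p (1 - p)\<close> of its energy. This is the mean over \<open>p\<close> of the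
  resulting growth factor of \<open>Vfun\<close>.\<close>

definition jump_const :: "real \<Rightarrow> ennreal" where
  "jump_const \<eta> = (\<integral>\<^sup>+p\<in>{0<..<1}. ennreal (min p (1 - p) powr (\<eta> / 2 - 1)) \<partial>lborel)"

text \<open>The integrand is singular at 0 and at 1, with exponent above -1 since
  \<open>\<eta> > 0\<close>. It is bounded by the sum of the two one-sided powers, which reflection
  maps to each other.\<close>

lemma jump_const_finite:
  assumes "0 < \<eta>"
  shows "jump_const \<eta> < \<infinity>"
proof -
  let ?e = "\<eta> / 2 - 1"
  let ?f = "\<lambda>p. ennreal (p powr ?e) * indicator {0..1::real} p"
  have fin: "(\<integral>\<^sup>+p. ?f p \<partial>lborel) = ennreal (1 powr (?e + 1) / (?e + 1))"
    by (rule nn_integral_has_integral_lebesgue') (use has_integral_powr_from_0[of ?e 1] assms in auto)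
  \<comment> \<open>Affine substitution with slope -1, that is, the reflection of \<open>p\<close>
    to \<open>1 - p\<close>.\<close>
  have "(\<integral>\<^sup>+p. ?f p \<partial>lborel) = ennreal \<bar>-1\<bar> * (\<integral>\<^sup>+p. ?f (1 + (-1) * p) \<partial>lborel)"
    by (rule nn_integral_real_affine) auto
  then have refl: "(\<integral>\<^sup>+p. ?f (1 - p) \<partial>lborel) = (\<integral>\<^sup>+p. ?f p \<partial>lborel)"
    by (simp add: one_ennreal_def[symmetric])
  have "jump_const \<eta> \<le> (\<integral>\<^sup>+p. ?f p + ?f (1 - p) \<partial>lborel)"
    unfolding jump_const_def
    by (rule nn_integral_mono) (auto simp: min_def split: split_indicator)
  also have "\<dots> = (\<integral>\<^sup>+p. ?f p \<partial>lborel) + (\<integral>\<^sup>+p. ?f (1 - p) \<partial>lborel)"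
    by (rule nn_integral_add) auto
  also have "\<dots> < \<infinity>"
    unfolding refl fin by (simp add: ennreal_add_less_top)
  finally show ?thesis .
qed

text \<open>Sites \<open>i\<close> and \<open>Suc i\<close> receive at least the shares
  \<open>p\<close> and \<open>1 - p\<close> of their own former energies, so no site shrinks by more
  than \<open>min p (1 - p)\<close>.\<close>

lemma exchange_op_Vfun_le:
  assumes x: "x \<in> pos_states N" and i: "i < N - 1" and \<eta>: "0 < \<eta>" "\<eta> \<le> 1"
  shows "exchange_op i (\<lambda>y. ennreal (Vfun N \<eta> y)) x \<le> jump_const \<eta> * ennreal (Vfun N \<eta> x)"
proof -
  have "exchange_op i (\<lambda>y. ennreal (Vfun N \<eta> y)) x
      \<le> (\<integral>\<^sup>+p. (ennreal (min p (1 - p) powr (\<eta> / 2 - 1)) * indicator {0<..<1} p)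
            * ennreal (Vfun N \<eta> x) \<partial>lborel)"
    unfolding exchange_op_def
  proof (rule nn_integral_mono)
    fix p :: real
    show "ennreal (Vfun N \<eta> (exchange_state i x p)) * indicator {0<..<1} p \<le>
      (ennreal (min p (1 - p) powr (\<eta> / 2 - 1)) * indicator {0<..<1} p) * ennreal (Vfun N \<eta> x)"
    proof (cases "p \<in> {0<..<1}")
      case True
      have "Vfun N \<eta> (exchange_state i x p) \<le> min p (1 - p) powr (\<eta> / 2 - 1) * Vfun N \<eta> x"
      proof (rule Vfun_le_of_scaled_le[OF x _ _ \<eta>])
        fix j assume j: "j < N"
        have "0 < x j" "0 < x i" "0 < x (Suc i)" using x i j by (auto simp: pos_states_def)
        moreover have "min p (1 - p) * x j \<le> 1 * x j" "min p (1 - p) * x j \<le> p * x j"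
          "min p (1 - p) * x j \<le> (1 - p) * x j"
          using \<open>0 < x j\<close> True by (auto intro!: mult_right_mono)
        moreover have "0 \<le> p * x (Suc i)" "0 \<le> (1 - p) * x i"
          using True \<open>0 < x i\<close> \<open>0 < x (Suc i)\<close> by auto
        ultimately have "min p (1 - p) * x j \<le> x j" "min p (1 - p) * x j \<le> p * (x j + x (Suc i))"
          "min p (1 - p) * x j \<le> (1 - p) * (x i + x j)"
          unfolding distrib_left by linarith+
        then show "min p (1 - p) * x j \<le> exchange_state i x p j"
          by (cases "j = i"; cases "j = Suc i") (simp_all add: exchange_state_def)
      qed (use True in auto)
      then show ?thesis
        using True by (simp add: ennreal_mult'[symmetric] Vfun_nonneg)
    qed simp
  qed
  also have "\<dots> = jump_const \<eta> * ennreal (Vfun N \<eta> x)"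
    unfolding jump_const_def by (rule nn_integral_multc) auto
  finally show ?thesis .
qed

text \<open>The deposit \<open>X \<ge> 0\<close> only helps, so the bound is uniform in
  \<open>X\<close> and the density integrates to one. The factor \<open>min p (1 - p)\<close>, below
  \<open>p\<close>, yields the same constant as for exchanges.\<close>

lemma bath_op_Vfun_le:
  assumes x: "x \<in> pos_states N" and i: "i < N" and \<eta>: "0 < \<eta>" "\<eta> \<le> 1" and T: "T > 0"
  shows "bath_op i T (\<lambda>y. ennreal (Vfun N \<eta> y)) x \<le> jump_const \<eta> * ennreal (Vfun N \<eta> x)"
proof -
  have "bath_op i T (\<lambda>y. ennreal (Vfun N \<eta> y)) x
      \<le> (\<integral>\<^sup>+p. (ennreal (min p (1 - p) powr (\<eta> / 2 - 1)) * indicator {0<..<1} p)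
            * ennreal (Vfun N \<eta> x) \<partial>lborel)"
    unfolding bath_op_def
  proof (rule nn_integral_mono)
    fix p :: real
    let ?c = "ennreal (min p (1 - p) powr (\<eta> / 2 - 1) * Vfun N \<eta> x)"
    show "(\<integral>\<^sup>+X. ennreal (exponential_density (1 / T) X) * ennreal (Vfun N \<eta> (bath_state i x p X)) \<partial>lborel)
        * indicator {0<..<1} p \<le>
      (ennreal (min p (1 - p) powr (\<eta> / 2 - 1)) * indicator {0<..<1} p) * ennreal (Vfun N \<eta> x)"
    proof (cases "p \<in> {0<..<1}")
      case True
      have "Vfun N \<eta> (bath_state i x p X) \<le> min p (1 - p) powr (\<eta> / 2 - 1) * Vfun N \<eta> x" if "0 \<le> X" for X
      proof (rule Vfun_le_of_scaled_le[OF x _ _ \<eta>])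
        fix j assume j: "j < N"
        have "0 < x j" using x j by (auto simp: pos_states_def)
        moreover have "min p (1 - p) * x j \<le> 1 * x j" "min p (1 - p) * x j \<le> p * x j"
          using \<open>0 < x j\<close> True by (auto intro!: mult_right_mono)
        moreover have "0 \<le> p * X" using True that by auto
        ultimately have "min p (1 - p) * x j \<le> x j" "min p (1 - p) * x j \<le> p * (x j + X)"
          unfolding distrib_left by linarith+
        then show "min p (1 - p) * x j \<le> bath_state i x p X j"
          by (cases "j = i") (simp_all add: bath_state_def)
      qed (use True in auto)
      then have "(\<integral>\<^sup>+X. ennreal (exponential_density (1 / T) X) * ennreal (Vfun N \<eta> (bath_state i x p X)) \<partial>lborel)
         \<le> (\<integral>\<^sup>+X. ennreal (exponential_density (1 / T) X) * ?c \<partial>lborel)"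
        by (intro nn_integral_mono)
          (auto simp: exponential_density_def not_less intro!: mult_left_mono ennreal_leI)
      also have "\<dots> = ?c" by (rule nn_integral_exponential_const[OF T])
      finally show ?thesis
        using True by (simp add: ennreal_mult'[symmetric] Vfun_nonneg)
    qed simp
  qed
  also have "\<dots> = jump_const \<eta> * ennreal (Vfun N \<eta> x)"
    unfolding jump_const_def by (rule nn_integral_multc) auto
  finally show ?thesis .
qed

section \<open>Jump rates and Poisson weights\<close>

lemma rate_nonneg: "0 \<le> K \<Longrightarrow> 0 \<le> a \<Longrightarrow> 0 \<le> b \<Longrightarrow> 0 \<le> rate K a b"
  by (simp add: rate_def)

lemma rate_le: "rate K a b \<le> K"
  by (simp add: rate_def)

lemma rate_mono: "a \<le> a' \<Longrightarrow> b \<le> b' \<Longrightarrow> rate K a b \<le> rate K a' b'"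
  unfolding rate_def by (intro min.mono real_sqrt_le_mono order_refl)

lemma unif_rate_pos: "0 < K \<Longrightarrow> 0 < unif_rate N K"
  by (simp add: unif_rate_def)

lemma ennreal_add_Suc_mult:
  assumes "0 \<le> w" "0 \<le> c"
  shows "ennreal (w + c) + ennreal (real n * c) = ennreal (w + real (Suc n) * c)"
  using assms by (subst ennreal_plus[symmetric]) (auto simp: algebra_simps)

text \<open>The generating function of the Poisson law with mean \<open>a\<close>. It sums
  uniformization series whose terms grow geometrically.\<close>

lemma poisson_sums:
  fixes a r :: real
  shows "(\<lambda>n. exp (- a) * a ^ n / fact n * r ^ n) sums exp (a * (r - 1))"
proof -
  have "(\<lambda>n. exp (- a) * ((a * r) ^ n /\<^sub>R fact n)) sums (exp (- a) * exp (a * r))"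
    by (rule sums_mult[OF exp_converges])
  then show ?thesis
    by (simp add: power_mult_distrib field_simps exp_add[symmetric] scaleR_conv_of_real)
qed

section \<open>One step of the uniformized chain\<close>

context
  fixes N :: nat and K TL TR :: real
  assumes N: "N \<ge> 1" and K: "K > 0" and TL: "TL > 0" and TR: "TR > 0"
begin

text \<open>There are \<open>N - 1\<close> exchange clocks and two bath clocks, each of rate at most
  \<open>K\<close>. Hence the holding probability in \<open>Qop\<close> is a genuine nonnegative
  number.\<close>

lemma total_rate_le:
  "total_rate N K TL TR x \<le> unif_rate N K"
proof -
  have "(\<Sum>i<N - 1. rate K (x i) (x (Suc i))) \<le> (\<Sum>i<N - 1. K)"
    by (rule sum_mono) (rule rate_le)
  then have "(\<Sum>i<N - 1. rate K (x i) (x (Suc i))) \<le> real (N - 1) * K" by simp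
  then have "total_rate N K TL TR x \<le> real (N - 1) * K + K + K"
    unfolding total_rate_def by (intro add_mono rate_le)
  then show ?thesis
    using N by (simp add: unif_rate_def of_nat_diff algebra_simps)
qed

lemma rates_nonneg:
  assumes "x \<in> pos_states N"
  shows "i < N - 1 \<Longrightarrow> 0 \<le> rate K (x i) (x (Suc i))" "0 \<le> rate K TL (x 0)" "0 \<le> rate K (x (N - 1)) TR"
  using assms N K TL TR by (auto intro!: rate_nonneg simp: pos_states_def less_imp_le)

text \<open>The weights of all moves add up to one, so the common bound \<open>e\<close> for staying
  and exchanging is corrected only by the two bath terms.\<close>

lemma Qop_le:
  assumes x: "x \<in> pos_states N" and nonneg: "0 \<le> e" "0 \<le> bL" "0 \<le> bR"
    and f: "f x \<le> ennreal e" and ex: "\<And>i. i < N - 1 \<Longrightarrow> exchange_op i f x \<le> ennreal e"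
    and L: "bath_op 0 TL f x \<le> ennreal bL" and R: "bath_op (N - 1) TR f x \<le> ennreal bR"
  shows "Qop N K TL TR f x \<le> ennreal (e +
     (rate K TL (x 0) * (bL - e) + rate K (x (N - 1)) TR * (bR - e)) / unif_rate N K)"
proof -
  let ?l = "unif_rate N K" and ?rL = "rate K TL (x 0)" and ?rR = "rate K (x (N - 1)) TR"
  let ?s = "\<Sum>i<N - 1. rate K (x i) (x (Suc i))" and ?t = "total_rate N K TL TR x"
  note r = rates_nonneg[OF x]
  have s: "0 \<le> ?s" by (rule sum_nonneg) (use r in auto)
  have "jump_part N K TL TR f x \<le> (\<Sum>i<N - 1. ennreal (rate K (x i) (x (Suc i))) * ennreal e)
     + ennreal ?rL * ennreal bL + ennreal ?rR * ennreal bR"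
    unfolding jump_part_eq by (intro add_mono sum_mono mult_left_mono ex L R) auto
  also have "(\<Sum>i<N - 1. ennreal (rate K (x i) (x (Suc i))) * ennreal e) = ennreal ?s * ennreal e"
    by (subst sum_distrib_right[symmetric], subst sum_ennreal) (use r in auto)
  also have "ennreal ?s * ennreal e + ennreal ?rL * ennreal bL + ennreal ?rR * ennreal bR
      = ennreal (?s * e + ?rL * bL + ?rR * bR)"
    using r s nonneg by (simp add: ennreal_mult)
  finally have "Qop N K TL TR f x \<le> ennreal (1 / ?l) * ennreal (?s * e + ?rL * bL + ?rR * bR)
      + ennreal (1 - ?t / ?l) * ennreal e"
    unfolding Qop_def by (intro add_mono mult_left_mono f) auto
  also have "\<dots> = ennreal (1 / ?l * (?s * e + ?rL * bL + ?rR * bR) + (1 - ?t / ?l) * e)"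
  proof -
    have "0 \<le> ?s * e + ?rL * bL + ?rR * bR" "0 \<le> 1 - ?t / ?l" "0 \<le> 1 / ?l"
      using unif_rate_pos[OF K, of N] total_rate_le[of x] r s nonneg by auto
    then show ?thesis
      using nonneg(1) by (simp only: ennreal_mult ennreal_plus mult_nonneg_nonneg)
  qed
  also have "1 / ?l * (?s * e + ?rL * bL + ?rR * bR) + (1 - ?t / ?l) * e
      = e + (?rL * (bL - e) + ?rR * (bR - e)) / ?l"
    using unif_rate_pos[OF K, of N] unfolding total_rate_def by (simp add: field_simps)
  finally show ?thesis .
qed

lemma Qop_const_le:
  assumes "x \<in> pos_states N" and "0 \<le> a"
  shows "Qop N K TL TR (\<lambda>_. ennreal a) x \<le> ennreal a"
  using Qop_le[of x a a a "\<lambda>_. ennreal a"] assms TL TR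
  by (simp add: exchange_op_def bath_op_def nn_integral_unit_interval_const nn_integral_exponential_const)

lemma Qop_ge_exchange:
  assumes x: "x \<in> pos_states N" and i: "i < N - 1"
  shows "ennreal (rate K (x i) (x (Suc i)) / unif_rate N K) * exchange_op i f x \<le> Qop N K TL TR f x"
proof -
  have "ennreal (rate K (x i) (x (Suc i))) * exchange_op i f x \<le> jump_part N K TL TR f x"
    unfolding jump_part_eq using i
    by (intro add_increasing2 member_le_sum[of i "{..<N - 1}"]) auto
  then have "ennreal (1 / unif_rate N K) * (ennreal (rate K (x i) (x (Suc i))) * exchange_op i f x)
      \<le> Qop N K TL TR f x"
    unfolding Qop_def by (intro add_increasing2 mult_left_mono) auto
  then show ?thesis
    using unif_rate_pos[OF K, of N] by (simp add: ennreal_mult''[symmetric] mult.assoc[symmetric] ennreal_mult'[symmetric])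
qed

text \<open>Each bath adds at most half its temperature and removes half the energy of its site,
  weighted by its jump probability. Only the loss on the left is recorded; it stands on the
  left-hand side to avoid subtraction in \<open>ennreal\<close>.\<close>

lemma Qop_Wfun_le:
  assumes x: "x \<in> pos_states N"
  shows "Qop N K TL TR (\<lambda>y. ennreal (Wfun N y)) x + ennreal (rate K TL (x 0) / (2 * unif_rate N K) * x 0)
      \<le> ennreal (Wfun N x + (TL + TR) / 2)"
proof -
  let ?l = "unif_rate N K" and ?rL = "rate K TL (x 0)" and ?rR = "rate K (x (N - 1)) TR"
  let ?W = "Wfun N x"
  have pos: "0 < x 0" "0 < x (N - 1)" "x 0 \<le> ?W" "x (N - 1) \<le> ?W" "0 \<le> ?W"
    using x N by (auto simp: pos_states_def coordinate_le_Wfun Wfun_nonneg)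
  note r = rates_nonneg(2,3)[OF x]
  let ?b = "?W + (?rL * (?W - x 0 / 2 + TL / 2 - ?W) + ?rR * (?W - x (N - 1) / 2 + TR / 2 - ?W)) / ?l"
  have "Qop N K TL TR (\<lambda>y. ennreal (Wfun N y)) x \<le> ennreal ?b"
    using N TL TR pos by (intro Qop_le x bath_op_Wfun_le) (auto simp: exchange_op_Wfun)
  have "K \<le> ?l" using K N by (simp add: unif_rate_def)
  then have q: "?rL / ?l \<le> 1" "?rR / ?l \<le> 1" "0 \<le> ?rL / ?l" "0 \<le> ?rR / ?l"
    using unif_rate_pos[OF K, of N] r rate_le[of K TL "x 0"] rate_le[of K "x (N - 1)" TR] by auto
  define a where "a = ?rL / ?l"
  define b where "b = ?rR / ?l"
  have eq: "?b = ?W - a * x 0 / 2 - b * x (N - 1) / 2 + a * TL / 2 + b * TR / 2"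
    using unif_rate_pos[OF K, of N] unfolding a_def b_def by (simp add: field_simps)
  have ab: "0 \<le> a" "a \<le> 1" "0 \<le> b" "b \<le> 1" using q by (simp_all add: a_def b_def)
  have "a * TL \<le> TL" "b * TR \<le> TR" "a * x 0 \<le> x 0" "b * x (N - 1) \<le> x (N - 1)"
    using mult_right_mono[OF ab(2), of TL] mult_right_mono[OF ab(4), of TR] mult_right_mono[OF ab(2), of "x 0"]
      mult_right_mono[OF ab(4), of "x (N - 1)"] TL TR pos by simp_all
  moreover have nn: "0 \<le> a * TL" "0 \<le> b * TR" "0 \<le> a * x 0" "0 \<le> b * x (N - 1)"
    using ab TL TR pos by (simp_all only: mult_nonneg_nonneg less_imp_le)
  \<comment> \<open>Linear arithmetic with the products abstracted: \<open>p\<close>,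
    \<open>q\<close> are the weighted boundary energies and \<open>r\<close>, \<open>s\<close> the
    weighted temperatures. The second claim keeps the cast exact.\<close>
  moreover have "(w - p / 2 - q / 2 + r / 2 + s / 2) + p / 2 \<le> w + (TL + TR) / 2"
      "0 \<le> w - p / 2 - q / 2 + r / 2 + s / 2"
    if "r \<le> TL" "s \<le> TR" "p \<le> w" "q \<le> w" "0 \<le> r" "0 \<le> s" "0 \<le> q" for w p q r s :: real
    using that by (simp_all add: field_simps)
  ultimately have le: "?b + a * x 0 / 2 \<le> ?W + (TL + TR) / 2" and b0: "0 \<le> ?b"
    unfolding eq using pos by (meson order_trans)+
  have "?rL / (2 * ?l) * x 0 = a * x 0 / 2" by (simp add: a_def)
  then have "Qop N K TL TR (\<lambda>y. ennreal (Wfun N y)) x + ennreal (?rL / (2 * ?l) * x 0)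
      \<le> ennreal ?b + ennreal (a * x 0 / 2)"
    using \<open>Qop N K TL TR (\<lambda>y. ennreal (Wfun N y)) x \<le> ennreal ?b\<close> by (simp only: add_right_mono)
  also have "\<dots> = ennreal (?b + a * x 0 / 2)"
    using b0 nn by (intro ennreal_plus[symmetric]) auto
  finally show ?thesis
    using ennreal_leI[OF le] by (rule order_trans)
qed

lemma Qop_Vfun_le:
  assumes \<eta>: "0 < \<eta>" "\<eta> \<le> 1"
  shows "\<exists>C\<ge>1. \<forall>x\<in>pos_states N. Qop N K TL TR (\<lambda>y. ennreal (Vfun N \<eta> y)) x \<le> ennreal (C * Vfun N \<eta> x)"
proof -
  \<comment> \<open>The maximum with 1 also covers the event that no jump occurs, where
    \<open>Vfun\<close> is unchanged.\<close>
  define C where "C = max 1 (enn2real (jump_const \<eta>))"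
  have "ennreal (enn2real (jump_const \<eta>)) = jump_const \<eta>"
    using jump_const_finite[OF \<eta>(1)] by simp
  then have C: "jump_const \<eta> \<le> ennreal C"
    unfolding C_def by (metis ennreal_leI max.cobounded2)
  have C1: "1 \<le> C" by (simp add: C_def)
  have "Qop N K TL TR (\<lambda>y. ennreal (Vfun N \<eta> y)) x \<le> ennreal (C * Vfun N \<eta> x)" if x: "x \<in> pos_states N" for x
  proof -
    let ?v = "C * Vfun N \<eta> x"
    have v: "jump_const \<eta> * ennreal (Vfun N \<eta> x) \<le> ennreal ?v"
      using mult_right_mono[OF C, of "ennreal (Vfun N \<eta> x)"] C1 by (simp add: ennreal_mult Vfun_nonneg)
    have "Vfun N \<eta> x \<le> ?v"
      using mult_right_mono[OF C1 Vfun_nonneg[of N \<eta> x]] by simp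
    then have "Qop N K TL TR (\<lambda>y. ennreal (Vfun N \<eta> y)) x \<le> ennreal (?v +
       (rate K TL (x 0) * (?v - ?v) + rate K (x (N - 1)) TR * (?v - ?v)) / unif_rate N K)"
      using C1 N
      by (intro Qop_le x order_trans[OF exchange_op_Vfun_le[OF x _ \<eta>] v]
          order_trans[OF bath_op_Vfun_le[OF x _ \<eta> TL] v] order_trans[OF bath_op_Vfun_le[OF x _ \<eta> TR] v])
        (auto simp: Vfun_nonneg ennreal_leI)
    then show ?thesis by simp
  qed
  with C1 show ?thesis by blast
qed

section \<open>Iterated jumps\<close>

lemma Qop_funpow_Wfun_le:
  assumes "x \<in> pos_states N"
  shows "((Qop N K TL TR ^^ n) (\<lambda>y. ennreal (Wfun N y))) x \<le> ennreal (Wfun N x + real n * ((TL + TR) / 2))"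
  using assms
proof (induction n arbitrary: x)
  case (Suc n)
  let ?c = "(TL + TR) / 2"
  note Q = positive_operator_Qop[OF N, of K TL TR]
  have c: "0 \<le> ?c" using TL TR by simp
  have "(Qop N K TL TR ^^ Suc n) (\<lambda>y. ennreal (Wfun N y)) x
      \<le> Qop N K TL TR (\<lambda>y. ennreal (Wfun N y) + ennreal (real n * ?c)) x"
    unfolding funpow.simps o_def using Suc c
    by (intro positive_operator_mono[OF Q]) (auto simp: ennreal_plus[symmetric] Wfun_nonneg simp del: ennreal_plus)
  also have "\<dots> = Qop N K TL TR (\<lambda>y. ennreal (Wfun N y)) x + Qop N K TL TR (\<lambda>y. ennreal (real n * ?c)) x"
    by (rule positive_operator_add[OF Q]) (use Suc in auto)
  also have "\<dots> \<le> ennreal (Wfun N x + ?c) + ennreal (real n * ?c)"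
    using Qop_Wfun_le[OF Suc.prems] c Suc.prems
    by (intro add_mono Qop_const_le) (auto intro: order_trans[OF add_increasing2[OF zero_le order_refl]])
  also have "\<dots> = ennreal (Wfun N x + real (Suc n) * ?c)"
    by (rule ennreal_add_Suc_mult) (use c Wfun_nonneg[OF Suc.prems] in auto)
  finally show ?case .
qed simp

text \<open>Energy is lost only through the baths, so energy at sites up to \<open>k\<close> needs \<open>k + 1\<close> jumps
  to contribute: exchanges with \<open>p\<close> in the middle of the unit interval pass a quarter of it one site
  to the left while at most halving the lower bound on the energies.\<close>

lemma Qop_funpow_Wfun_drop:
  assumes "k < N" "0 < \<epsilon>"
  shows "\<exists>d>0. \<forall>x\<in>pos_states N. (\<forall>i<N. \<epsilon> \<le> x i) \<longrightarrow>
    ((Qop N K TL TR ^^ Suc k) (\<lambda>y. ennreal (Wfun N y))) x + ennreal (d * (\<Sum>i<Suc k. x i))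
      \<le> ennreal (Wfun N x + real (Suc k) * ((TL + TR) / 2))"
  using assms
proof (induction k arbitrary: \<epsilon>)
  case 0
  \<comment> \<open>The smallest probability of a left bath jump when the first site has energy at
    least \<open>\<epsilon>\<close>, times the half that is lost.\<close>
  let ?d = "rate K TL \<epsilon> / (2 * unif_rate N K)"
  have "?d > 0"
    using K TL 0 unif_rate_pos[OF K, of N] by (simp add: rate_def)
  moreover have "Qop N K TL TR (\<lambda>y. ennreal (Wfun N y)) x + ennreal (?d * x 0)
      \<le> ennreal (Wfun N x + (TL + TR) / 2)"
    if x: "x \<in> pos_states N" and e: "\<forall>i<N. \<epsilon> \<le> x i" for x
  proof -
    have "?d * x 0 \<le> rate K TL (x 0) / (2 * unif_rate N K) * x 0"
      using e 0 unif_rate_pos[OF K, of N] by (intro mult_right_mono divide_right_mono rate_mono) auto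
    then show ?thesis
      using Qop_Wfun_le[OF x] by (meson add_left_mono ennreal_leI order_trans)
  qed
  ultimately show ?case by (intro exI[of _ ?d]) auto
next
  case (Suc k)
  let ?Q = "Qop N K TL TR" and ?W = "\<lambda>y. ennreal (Wfun N y)" and ?c = "(TL + TR) / 2"
  note Q = positive_operator_Qop[OF N, of K TL TR]
  have c: "0 \<le> ?c" using TL TR by simp
  obtain d where d: "d > 0" and IH: "\<And>x. x \<in> pos_states N \<Longrightarrow> (\<forall>i<N. \<epsilon> / 2 \<le> x i) \<Longrightarrow>
      (?Q ^^ Suc k) ?W x + ennreal (d * (\<Sum>i<Suc k. x i)) \<le> ennreal (Wfun N x + real (Suc k) * ?c)"
    using Suc.IH[of "\<epsilon> / 2"] Suc.prems by auto
  \<comment> \<open>The loss guaranteed over the remaining \<open>Suc k\<close> jumps, set to zero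
    where the lower bound \<open>\<epsilon> / 2\<close> fails.\<close>
  define g where "g = (\<lambda>y::state. if \<forall>i<N. \<epsilon> / 2 \<le> y i then ennreal (d * (\<Sum>i<Suc k. y i)) else 0)"
  \<comment> \<open>Lowest probability of the exchange at \<open>k\<close>, times \<open>d\<close>,
    times 1/4 for the share passed on and 1/2 for the length of the window
    \<open>{1 / 4..3 / 4}\<close>.\<close>
  define d' where "d' = rate K \<epsilon> \<epsilon> / unif_rate N K * (d / 8)"
  have g[measurable]: "g \<in> borel_measurable state_algebra"
    unfolding g_def by measurable
  have [measurable]: "(?Q ^^ Suc k) ?W \<in> borel_measurable state_algebra"
    by (rule positive_operator_measurable[OF positive_operator_funpow[OF Q]]) measurable
  have rate_pos: "0 < rate K \<epsilon> \<epsilon>" using K Suc.prems by (simp add: rate_def)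
  then have d': "d' > 0"
    unfolding d'_def using d unif_rate_pos[OF K, of N] by simp
  have "(?Q ^^ Suc (Suc k)) ?W x + ennreal (d' * (\<Sum>i<Suc (Suc k). x i))
      \<le> ennreal (Wfun N x + real (Suc (Suc k)) * ?c)"
    if x: "x \<in> pos_states N" and e: "\<forall>i<N. \<epsilon> \<le> x i" for x
  proof -
    let ?s = "\<Sum>i<Suc (Suc k). x i"
    have k: "k < N - 1" "k < N" "Suc k < N" using Suc.prems by auto
    have s: "0 \<le> ?s" by (rule sum_nonneg) (use x k in \<open>auto simp: pos_states_def less_Suc_eq less_imp_le\<close>)
    have "ennreal (d / 8 * ?s) = (\<integral>\<^sup>+p. ennreal (d / 4 * ?s) * indicator {1 / 4..3 / 4::real} p \<partial>lborel)"
      using d s by (subst nn_integral_cmult_indicator, simp, subst emeasure_lborel_Icc, simp,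
          subst ennreal_mult[symmetric]) auto
    also have "\<dots> \<le> exchange_op k g x"
      unfolding exchange_op_def
    proof (rule nn_integral_mono)
      fix p :: real
      show "ennreal (d / 4 * ?s) * indicator {1 / 4..3 / 4} p \<le> g (exchange_state k x p) * indicator {0<..<1} p"
      proof (cases "p \<in> {1 / 4..3 / 4}")
        case True
        let ?y = "exchange_state k x p" and ?t = "x k + x (Suc k)"
        have t: "2 * \<epsilon> \<le> ?t" using e k by (simp add: add_mono[of \<epsilon> _ \<epsilon>, simplified])
        have pt: "1 / 4 * ?t \<le> p * ?t" "1 / 4 * ?t \<le> (1 - p) * ?t"
          using True t Suc.prems by (intro mult_right_mono; simp)+
        have "\<epsilon> / 2 \<le> ?y i" if "i < N" for i
        proof -
          have "\<epsilon> / 2 \<le> 1 / 4 * ?t" using t by simp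
          then have "\<epsilon> / 2 \<le> p * ?t" "\<epsilon> / 2 \<le> (1 - p) * ?t" using pt by (metis order_trans)+
          moreover have "\<epsilon> \<le> x i" using e that by simp
          ultimately show ?thesis using Suc.prems by (simp add: exchange_state_def)
        qed
        then have "g ?y = ennreal (d * (\<Sum>i<Suc k. ?y i))" by (simp add: g_def)
        \<comment> \<open>Site \<open>k\<close> now holds at least a quarter of the joint energy of
          \<open>k\<close> and \<open>Suc k\<close>, and the sites below \<open>k\<close> are
          unchanged.\<close>
        moreover have "1 / 4 * ?s \<le> (\<Sum>i<Suc k. ?y i)"
        proof -
          have "(\<Sum>i<k. ?y i) = (\<Sum>i<k. x i)" "?y k = p * ?t"
            by (auto simp: exchange_state_def intro!: sum.cong)
          moreover have "0 \<le> (\<Sum>i<k. x i)"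
            by (rule sum_nonneg) (use x k in \<open>auto simp: pos_states_def less_imp_le\<close>)
          ultimately show ?thesis using pt by simp
        qed
        then have "d / 4 * ?s \<le> d * (\<Sum>i<Suc k. ?y i)"
          using mult_left_mono[of "1 / 4 * ?s" _ d] d by simp
        ultimately show ?thesis using True by (auto intro: ennreal_leI)
      qed simp
    qed
    finally have ex: "ennreal (d / 8 * ?s) \<le> exchange_op k g x" .
    have "rate K \<epsilon> \<epsilon> / unif_rate N K \<le> rate K (x k) (x (Suc k)) / unif_rate N K"
      using e k unif_rate_pos[OF K, of N] by (intro divide_right_mono rate_mono) auto
    then have "ennreal (rate K \<epsilon> \<epsilon> / unif_rate N K) * ennreal (d / 8 * ?s)
        \<le> ennreal (rate K (x k) (x (Suc k)) / unif_rate N K) * exchange_op k g x"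
      by (intro mult_mono ex ennreal_leI) auto
    also have "\<dots> \<le> ?Q g x" by (rule Qop_ge_exchange[OF x k(1)])
    finally have Qg: "ennreal (d' * ?s) \<le> ?Q g x"
      using rate_pos unif_rate_pos[OF K, of N] unfolding d'_def by (simp add: ennreal_mult'[symmetric] mult.assoc)
    have "(?Q ^^ Suc (Suc k)) ?W x + ennreal (d' * ?s) \<le> ?Q ((?Q ^^ Suc k) ?W) x + ?Q g x"
      using Qg by (simp add: add_left_mono)
    also have "\<dots> = ?Q (\<lambda>y. (?Q ^^ Suc k) ?W y + g y) x"
      by (rule positive_operator_add[OF Q, symmetric]) (use x in measurable)
    also have "\<dots> \<le> ?Q (\<lambda>y. ?W y + ennreal (real (Suc k) * ?c)) x"
    \<comment> \<open>Where \<open>g\<close> is nonzero the induction hypothesis applies; elsewhere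
      the plain growth bound suffices.\<close>
    proof (rule positive_operator_mono[OF Q _ x])
      fix y assume y: "y \<in> pos_states N"
      have "?W y + ennreal (real (Suc k) * ?c) = ennreal (Wfun N y + real (Suc k) * ?c)"
        by (rule ennreal_plus[symmetric]) (use c Wfun_nonneg[OF y] in auto)
      then show "(?Q ^^ Suc k) ?W y + g y \<le> ?W y + ennreal (real (Suc k) * ?c)"
        using IH[OF y] Qop_funpow_Wfun_le[OF y, of "Suc k"] by (simp add: g_def del: funpow.simps)
    qed
    also have "\<dots> = ?Q ?W x + ?Q (\<lambda>y. ennreal (real (Suc k) * ?c)) x"
      by (rule positive_operator_add[OF Q _ _ x]) auto
    also have "\<dots> \<le> ennreal (Wfun N x + ?c) + ennreal (real (Suc k) * ?c)"
      using c Qop_funpow_Wfun_le[OF x, of 1] by (intro add_mono Qop_const_le[OF x]) auto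
    also have "\<dots> = ennreal (Wfun N x + real (Suc (Suc k)) * ?c)"
      by (rule ennreal_add_Suc_mult) (use c Wfun_nonneg[OF x] in auto)
    finally show ?thesis .
  qed
  with d' show ?case by blast
qed

lemma Qop_funpow_Vfun_le:
  assumes C: "C \<ge> 0" "\<And>x. x \<in> pos_states N \<Longrightarrow> Qop N K TL TR (\<lambda>y. ennreal (Vfun N \<eta> y)) x \<le> ennreal (C * Vfun N \<eta> x)"
    and x: "x \<in> pos_states N"
  shows "((Qop N K TL TR ^^ n) (\<lambda>y. ennreal (Vfun N \<eta> y))) x \<le> ennreal (C ^ n * Vfun N \<eta> x)"
  using x
proof (induction n arbitrary: x)
  case (Suc n)
  note Q = positive_operator_Qop[OF N, of K TL TR]
  have "(Qop N K TL TR ^^ Suc n) (\<lambda>y. ennreal (Vfun N \<eta> y)) x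
      \<le> Qop N K TL TR (\<lambda>y. ennreal (C ^ n) * ennreal (Vfun N \<eta> y)) x"
    unfolding funpow.simps o_def using Suc C(1)
    by (intro positive_operator_mono[OF Q]) (auto simp: ennreal_mult[symmetric] Vfun_nonneg)
  also have "\<dots> = ennreal (C ^ n) * Qop N K TL TR (\<lambda>y. ennreal (Vfun N \<eta> y)) x"
    by (rule positive_operator_cmult[OF Q]) (use Suc in auto)
  also have "\<dots> \<le> ennreal (C ^ n) * ennreal (C * Vfun N \<eta> x)"
    by (intro mult_left_mono C(2) Suc) auto
  also have "\<dots> = ennreal (C ^ Suc n * Vfun N \<eta> x)"
    using C(1) by (simp add: ennreal_mult[symmetric] Vfun_nonneg mult_ac)
  finally show ?case .
qed simp

section \<open>Poisson averaging: from jumps to the time-\<open>h\<close> kernel\<close>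

lemma Pt_Vfun_le:
  assumes C: "C \<ge> 0" "\<And>x. x \<in> pos_states N \<Longrightarrow> Qop N K TL TR (\<lambda>y. ennreal (Vfun N \<eta> y)) x \<le> ennreal (C * Vfun N \<eta> x)"
    and x: "x \<in> pos_states N" and h: "h > 0"
  shows "Pt N K TL TR h (\<lambda>y. ennreal (Vfun N \<eta> y)) x
    \<le> ennreal (exp (unif_rate N K * h * (C - 1)) * Vfun N \<eta> x)"
proof -
  let ?a = "unif_rate N K * h"
  let ?w = "\<lambda>n. exp (- ?a) * ?a ^ n / fact n"
  have w: "0 \<le> ?w n" for n using h unif_rate_pos[OF K, of N] by simp
  have s: "(\<lambda>n. ?w n * C ^ n * Vfun N \<eta> x) sums (exp (?a * (C - 1)) * Vfun N \<eta> x)"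
    by (rule sums_mult2[OF poisson_sums])
  have "Pt N K TL TR h (\<lambda>y. ennreal (Vfun N \<eta> y)) x \<le> (\<Sum>n. ennreal (?w n * C ^ n * Vfun N \<eta> x))"
    unfolding Pt_def mult_minus_left
  proof (intro suminf_le summableI)
    fix n
    have "ennreal (?w n) * (Qop N K TL TR ^^ n) (\<lambda>y. ennreal (Vfun N \<eta> y)) x
        \<le> ennreal (?w n) * ennreal (C ^ n * Vfun N \<eta> x)"
      by (intro mult_left_mono Qop_funpow_Vfun_le[OF C x]) auto
    also have "\<dots> = ennreal (?w n * C ^ n * Vfun N \<eta> x)"
      using C(1) w by (simp only: ennreal_mult[symmetric] Vfun_nonneg mult_nonneg_nonneg zero_le_power mult.assoc)
    finally show "ennreal (?w n) * (Qop N K TL TR ^^ n) (\<lambda>y. ennreal (Vfun N \<eta> y)) x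
      \<le> ennreal (?w n * C ^ n * Vfun N \<eta> x)" .
  qed
  also have "\<dots> = ennreal (exp (?a * (C - 1)) * Vfun N \<eta> x)"
    using s w C(1) Vfun_nonneg[of N \<eta> x]
    by (subst suminf_ennreal2) (auto simp: sums_iff simp del: times_divide_eq_left intro!: mult_nonneg_nonneg)
  finally show ?thesis .
qed

text \<open>The number \<open>z\<close> is a loss known after exactly \<open>m\<close> jumps; it
  survives with the Poisson weight of \<open>m\<close>. Taking \<open>m\<close> and \<open>z\<close>
  zero gives the plain growth bound.\<close>

lemma Pt_Wfun_le:
  assumes x: "x \<in> pos_states N" and h: "h > 0"
    and z: "((Qop N K TL TR ^^ m) (\<lambda>y. ennreal (Wfun N y))) x + z \<le> ennreal (Wfun N x + real m * ((TL + TR) / 2))"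
  shows "Pt N K TL TR h (\<lambda>y. ennreal (Wfun N y)) x
      + ennreal (exp (- unif_rate N K * h) * (unif_rate N K * h) ^ m / fact m) * z
    \<le> ennreal (Wfun N x + (TL + TR) / 2 * exp (unif_rate N K * h))"
proof -
  let ?a = "unif_rate N K * h" and ?c = "(TL + TR) / 2" and ?W = "\<lambda>y. ennreal (Wfun N y)"
  let ?w = "\<lambda>n. exp (- ?a) * ?a ^ n / fact n"
  have w: "0 \<le> ?w n" for n using h unif_rate_pos[OF K, of N] by simp
  have c: "0 \<le> ?c" using TL TR by simp
  note W0 = Wfun_nonneg[OF x]
  \<comment> \<open>The cases \<open>r = 1\<close> and \<open>r = 2\<close> of the generating
    function: the linear growth \<open>n\<close> is dominated by \<open>2 ^ n\<close>, which costs
    the factor \<open>exp ?a\<close>.\<close>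
  have "(\<lambda>n. ?w n * 1 ^ n * Wfun N x + ?w n * 2 ^ n * ?c) sums
      (exp (?a * (1 - 1)) * Wfun N x + exp (?a * (2 - 1)) * ?c)"
    by (intro sums_add sums_mult2 poisson_sums)
  then have s: "(\<lambda>n. ?w n * (Wfun N x + 2 ^ n * ?c)) sums (Wfun N x + ?c * exp ?a)"
    by (simp only: power_one mult_1_right distrib_left mult.assoc right_diff_distrib) (simp add: mult_ac)
  have "Pt N K TL TR h ?W x + ennreal (?w m) * z
      = (\<Sum>n. ennreal (?w n) * (Qop N K TL TR ^^ n) ?W x) + (\<Sum>n. if n = m then ennreal (?w n) * z else 0)"
    unfolding Pt_def mult_minus_left by (subst (2) suminf_finite[of "{m}"]) simp_all
  also have "\<dots> = (\<Sum>n. ennreal (?w n) * (Qop N K TL TR ^^ n) ?W x + (if n = m then ennreal (?w n) * z else 0))"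
    by (rule suminf_add) (rule summableI)+
  also have "\<dots> \<le> (\<Sum>n. ennreal (?w n * (Wfun N x + 2 ^ n * ?c)))"
  proof (intro suminf_le summableI)
    fix n
    have "ennreal (?w n) * (Qop N K TL TR ^^ n) ?W x + (if n = m then ennreal (?w n) * z else 0)
        = ennreal (?w n) * ((Qop N K TL TR ^^ n) ?W x + (if n = m then z else 0))"
      by (simp add: distrib_left)
    also have "\<dots> \<le> ennreal (?w n) * ennreal (Wfun N x + real n * ?c)"
      using z Qop_funpow_Wfun_le[OF x, of n] by (intro mult_left_mono) auto
    also have "\<dots> \<le> ennreal (?w n) * ennreal (Wfun N x + 2 ^ n * ?c)"
      using c by (intro mult_left_mono ennreal_leI add_left_mono mult_right_mono)
        (auto intro: less_imp_le of_nat_less_two_power)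
    also have "\<dots> = ennreal (?w n * (Wfun N x + 2 ^ n * ?c))"
      using w by (rule ennreal_mult'[symmetric])
    finally show "ennreal (?w n) * (Qop N K TL TR ^^ n) ?W x + (if n = m then ennreal (?w n) * z else 0)
      \<le> ennreal (?w n * (Wfun N x + 2 ^ n * ?c))" .
  qed
  also have "\<dots> = ennreal (Wfun N x + ?c * exp ?a)"
    using s by (subst suminf_ennreal2) (auto simp: sums_iff simp del: times_divide_eq_left
        intro!: mult_nonneg_nonneg w add_nonneg_nonneg W0 less_imp_le[OF TL] less_imp_le[OF TR])
  finally show ?thesis by simp
qed

end

text \<open>As \<open>aexp N 1 = 1\<close>, the terms with \<open>m = 1\<close> are the single-site
  powers with exponent \<open>\<eta> - 1 < 0\<close>. A bound on \<open>Vfun\<close> thus keeps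
  every site away from zero.\<close>

lemma coordinate_ge_of_Vfun_le:
  assumes x: "x \<in> pos_states N" and V: "Vfun N \<eta> x \<le> M" and \<eta>: "\<eta> < 1" and M: "0 < M" and i: "i < N"
  shows "M powr (1 / (\<eta> - 1)) \<le> x i"
proof (rule ccontr)
  let ?t = "\<lambda>m k. (\<Sum>j<m. x (k + j)) powr (aexp N m * \<eta> - 1)"
  have "x i powr (\<eta> - 1) = ?t 1 i"
    by (simp add: aexp_def)
  also have "\<dots> \<le> (\<Sum>k<N - 1 + 1. ?t 1 k)"
    by (rule member_le_sum) (use i in auto)
  also have "\<dots> \<le> Vfun N \<eta> x"
    unfolding Vfun_def
    by (rule member_le_sum[of 1 "{1..N}" "\<lambda>m. \<Sum>k<N - m + 1. ?t m k"])
      (use i in simp, intro sum_nonneg, simp_all)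
  finally have "x i powr (\<eta> - 1) \<le> M" using V by simp
  moreover assume "\<not> ?thesis"
  then have "(M powr (1 / (\<eta> - 1))) powr (\<eta> - 1) < x i powr (\<eta> - 1)"
    using x i \<eta> M by (intro powr_less_mono2_neg) (auto simp: pos_states_def)
  then have "M < x i powr (\<eta> - 1)"
    using \<eta> M by (simp add: powr_powr)
  ultimately show False by simp
qed

section \<open>The induced chain\<close>

theorem theorem5p1:
  fixes N :: nat and TL TR :: real
  assumes "N \<ge> 1" and "TL > 0" and "TR > 0"
  shows "\<exists>K0. \<forall>K \<ge> K0. \<exists>\<eta>0 > 0. \<forall>\<eta>. 0 < \<eta> \<and> \<eta> < \<eta>0 \<longrightarrow>
           (\<exists>h0 > 0. \<forall>h. 0 < h \<and> h < h0 \<longrightarrow>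
             (\<forall>M0 c0. M0 > 1 \<and> c0 > 0 \<and>
                (\<forall>x \<in> pos_states N. Vfun N \<eta> x > M0 \<longrightarrow>
                   Pt N K TL TR h (\<lambda>y. ennreal (Vfun N \<eta> y)) x
                     + ennreal (c0 * Vfun N \<eta> x powr (1 - 1 / (2 * (1 - \<eta>))))
                   \<le> ennreal (Vfun N \<eta> x))
              \<longrightarrow> (\<exists>M1 > 1. \<exists>\<delta> > 0.
                     \<forall>x \<in> {y \<in> pos_states N. Vfun N \<eta> y \<le> M0}. Wfun N x > M1 \<longrightarrow>
                       hatP N K TL TR h {y \<in> pos_states N. Vfun N \<eta> y \<le> M0}
                            (\<lambda>y. ennreal (Wfun N y)) x
                       \<le> ennreal ((1 - \<delta>) * Wfun N x))))"
proof -
  note N = assms(1) and TL = assms(2) and TR = assms(3)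
  have core: "\<exists>M1 > 1. \<exists>\<delta> > 0.
                \<forall>x \<in> {y \<in> pos_states N. Vfun N \<eta> y \<le> M0}. Wfun N x > M1 \<longrightarrow>
                  hatP N K TL TR h {y \<in> pos_states N. Vfun N \<eta> y \<le> M0} (\<lambda>y. ennreal (Wfun N y)) x
                    \<le> ennreal ((1 - \<delta>) * Wfun N x)"
    if K: "0 < K" and \<eta>: "0 < \<eta>" "\<eta> < 1 / 2" and h: "0 < h" and M0: "1 < M0" and c0: "0 < c0"
      and drift: "\<forall>x \<in> pos_states N. Vfun N \<eta> x > M0 \<longrightarrow>
                   Pt N K TL TR h (\<lambda>y. ennreal (Vfun N \<eta> y)) x
                     + ennreal (c0 * Vfun N \<eta> x powr (1 - 1 / (2 * (1 - \<eta>))))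
                   \<le> ennreal (Vfun N \<eta> x)"
    for K \<eta> h M0 c0 :: real
  proof -
    let ?G = "{y \<in> pos_states N. Vfun N \<eta> y \<le> M0}" and ?P = "Pt N K TL TR h"
    let ?W = "\<lambda>y. ennreal (Wfun N y)" and ?V = "\<lambda>y. ennreal (Vfun N \<eta> y)"
    let ?a = "unif_rate N K * h"
    note P = positive_operator_Pt[OF N, of K TL TR h]
    obtain C where C: "C \<ge> 1" "\<And>x. x \<in> pos_states N \<Longrightarrow> Qop N K TL TR ?V x \<le> ennreal (C * Vfun N \<eta> x)"
      using Qop_Vfun_le[OF N K TL TR, of \<eta>] \<eta> by auto
    define \<epsilon> where "\<epsilon> = M0 powr (1 / (\<eta> - 1))"
    \<comment> \<open>The case \<open>k = N - 1\<close>: after \<open>N\<close> jumps the loss is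
      proportional to the energy of all sites.\<close>
    obtain d where d: "d > 0" and drop: "\<And>x. x \<in> pos_states N \<Longrightarrow> \<forall>i<N. \<epsilon> \<le> x i \<Longrightarrow>
        (Qop N K TL TR ^^ N) ?W x + ennreal (d * Wfun N x) \<le> ennreal (Wfun N x + real N * ((TL + TR) / 2))"
      using Qop_funpow_Wfun_drop[OF N K TL TR, of "N - 1" \<epsilon>] N M0 unfolding Wfun_def \<epsilon>_def by auto
    \<comment> \<open>\<open>A\<close> bounds \<open>P\<^sup>h V\<close> on \<open>G\<close>,
      \<open>c1\<close> the gain of \<open>W\<close> in time \<open>h\<close>;
      \<open>B * c0 = c1\<close> lets the drift of \<open>B V\<close> pay for that gain.
      \<open>w\<close> is the Poisson weight of \<open>N\<close> jumps, and \<open>D\<close>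
      collects the additive errors.\<close>
    define A where "A = exp (?a * (C - 1)) * M0"
    define c1 where "c1 = (TL + TR) / 2 * exp ?a"
    define B where "B = c1 / c0"
    define w where "w = exp (- unif_rate N K * h) * ?a ^ N / fact N"
    define D where "D = c1 + B * A"
    have pos: "0 < A" "0 < c1" "0 < B" "0 < w" "0 < D"
      using M0 TL TR c0 h unif_rate_pos[OF K, of N]
      by (simp_all add: A_def c1_def B_def w_def D_def add_pos_pos)
    define u where "u = (\<lambda>y. ?W y + ennreal B * ?V y)"
    have G: "?G \<in> sets state_algebra"
    proof -
      have "{y \<in> space state_algebra. y \<in> pos_states N \<and> Vfun N \<eta> y \<le> M0} \<in> sets state_algebra"
        by measurable
      then show ?thesis by (simp add: space_PiM)
    qed
    have Pu: "?P u y = ?P ?W y + ennreal B * ?P ?V y" if y: "y \<in> pos_states N" for y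
    proof -
      have "?P u y = ?P ?W y + ?P (\<lambda>y. ennreal B * ?V y) y"
        unfolding u_def by (rule positive_operator_add[OF P _ _ y]) measurable
      also have "?P (\<lambda>y. ennreal B * ?V y) y = ennreal B * ?P ?V y"
        by (rule positive_operator_cmult[OF P _ y]) measurable
      finally show ?thesis .
    qed
    have super: "?P u y \<le> u y" if y: "y \<in> pos_states N" "y \<notin> ?G" for y
    proof -
      let ?p = "Vfun N \<eta> y powr (1 - 1 / (2 * (1 - \<eta>)))"
      have V: "M0 < Vfun N \<eta> y" using y by auto
      \<comment> \<open>The exponent is nonnegative because \<open>\<eta> < 1 / 2\<close>, and
        \<open>Vfun\<close> exceeds \<open>M0 > 1\<close>; so the drift is at least
        \<open>c0\<close>.\<close>
      have "1 \<le> ?p"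
        using V M0 \<eta> by (intro ge_one_powr_ge_zero) (auto simp: field_simps)
      then have "c1 \<le> B * (c0 * ?p)"
        using mult_left_mono[of 1 ?p c1] pos c0 by (simp add: B_def)
      then have "ennreal c1 \<le> ennreal B * ennreal (c0 * ?p)"
        using pos by (simp add: ennreal_mult'[symmetric] ennreal_leI)
      moreover have "?P ?W y \<le> ?W y + ennreal c1"
      proof -
        have "?P ?W y \<le> ennreal (Wfun N y + c1)"
          unfolding c1_def using Pt_Wfun_le[OF N K TL TR y(1) h, of 0 0] by simp
        then show ?thesis
          using pos Wfun_nonneg[OF y(1)] by simp
      qed
      \<comment> \<open>The finite constant \<open>c1\<close> is added to both sides and cancelled
        at the end, in place of a subtraction.\<close>
      ultimately have "ennreal c1 + ?P u y
          \<le> ennreal B * ennreal (c0 * ?p) + ((?W y + ennreal c1) + ennreal B * ?P ?V y)"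
        unfolding Pu[OF y(1)] by (intro add_mono) auto
      also have "\<dots> = ennreal c1 + (?W y + ennreal B * (?P ?V y + ennreal (c0 * ?p)))"
        by (simp add: distrib_left add_ac)
      also have "\<dots> \<le> ennreal c1 + u y"
        unfolding u_def using drift y(1) V by (intro add_left_mono mult_left_mono) auto
      finally show ?thesis by (simp add: ennreal_add_left_cancel_le)
    qed
    have bound: "hatP N K TL TR h ?G ?W x + ennreal (w * d * Wfun N x) \<le> ennreal (Wfun N x + D)"
      if x: "x \<in> ?G" for x
    proof -
      have x': "x \<in> pos_states N" using x by simp
      have "hatP N K TL TR h ?G ?W x \<le> ?P u x"
        unfolding hatP_def
        by (rule killed_sum_le_superharmonic[OF P G _ _ _ super x']) (auto simp: u_def)
      moreover have "?P ?V x \<le> ennreal A"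
      proof -
        have "?P ?V x \<le> ennreal (exp (?a * (C - 1)) * Vfun N \<eta> x)"
          using C by (intro Pt_Vfun_le[OF N K TL TR _ _ x' h]) auto
        also have "\<dots> \<le> ennreal A"
          unfolding A_def using x by (intro ennreal_leI mult_left_mono) auto
        finally show ?thesis .
      qed
      ultimately have "hatP N K TL TR h ?G ?W x \<le> ?P ?W x + ennreal B * ennreal A"
        unfolding Pu[OF x'] by (meson add_left_mono mult_left_mono order_trans zero_le)
      then have "hatP N K TL TR h ?G ?W x + ennreal w * ennreal (d * Wfun N x)
          \<le> (?P ?W x + ennreal B * ennreal A) + ennreal w * ennreal (d * Wfun N x)"
        by (rule add_right_mono)
      also have "\<dots> = (?P ?W x + ennreal w * ennreal (d * Wfun N x)) + ennreal B * ennreal A"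
        by (simp only: add_ac)
      also have "\<dots> \<le> ennreal (Wfun N x + c1) + ennreal B * ennreal A"
      proof (rule add_right_mono)
        have "\<forall>i<N. \<epsilon> \<le> x i"
          using coordinate_ge_of_Vfun_le[OF x', of \<eta> M0] x \<eta> M0 by (auto simp: \<epsilon>_def)
        from Pt_Wfun_le[OF N K TL TR x' h drop[OF x' this]]
        show "?P ?W x + ennreal w * ennreal (d * Wfun N x) \<le> ennreal (Wfun N x + c1)"
          unfolding w_def c1_def .
      qed
      also have "\<dots> = ennreal (Wfun N x + D)"
        using pos Wfun_nonneg[OF x'] by (simp add: D_def ennreal_mult add.assoc)
      finally show ?thesis
        using pos by (simp add: ennreal_mult'[symmetric] mult.assoc)
    qed
    \<comment> \<open>Half of the loss \<open>w * d\<close> becomes the contraction; the other half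
      absorbs \<open>D\<close> once \<open>Wfun N x\<close> exceeds
      \<open>D / \<delta>\<close>.\<close>
    define \<delta> where "\<delta> = w * d / 2"
    have \<delta>: "0 < \<delta>" using pos d by (simp add: \<delta>_def)
    have "hatP N K TL TR h ?G ?W x \<le> ennreal ((1 - \<delta>) * Wfun N x)"
      if x: "x \<in> ?G" and large: "max 2 (D / \<delta>) < Wfun N x" for x
    proof -
      have DW: "D \<le> \<delta> * Wfun N x" "0 < Wfun N x" using large \<delta> by (auto simp: field_simps)
      have "hatP N K TL TR h ?G ?W x \<le> ennreal (Wfun N x + D)"
        using bound[OF x] by (meson add_increasing2 order_trans order_refl zero_le)
      \<comment> \<open>The value is finite, so the estimate can be rearranged over the
        reals.\<close>
      then obtain r where r: "0 \<le> r" "hatP N K TL TR h ?G ?W x = ennreal r"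
        by (cases "hatP N K TL TR h ?G ?W x") (auto simp: top_unique)
      have "ennreal (r + 2 * \<delta> * Wfun N x) \<le> ennreal (Wfun N x + D)"
        using bound[OF x] r \<delta> DW(2) by (simp add: \<delta>_def)
      then have "r + 2 * \<delta> * Wfun N x \<le> Wfun N x + D"
        using DW(2) pos by (subst (asm) ennreal_le_iff) auto
      then have "r \<le> (1 - \<delta>) * Wfun N x"
        using DW(1) by (simp add: algebra_simps)
      then show ?thesis using r(2) by (simp add: ennreal_leI)
    qed
    then show ?thesis
      using \<delta> by (intro exI[of _ "max 2 (D / \<delta>)"] conjI exI[of _ \<delta>]) auto
  qed
  show ?thesis
    \<comment> \<open>The thresholds 1, 1/2 and 1 for \<open>K\<close>, \<open>\<eta>\<close> and
      \<open>h\<close> provide the positivity of \<open>K\<close> and the range of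
      \<open>\<eta>\<close> that \<open>core\<close> asks for.\<close>
    by (rule exI[of _ 1], intro allI impI, rule exI[of _ "1 / 2"], intro conjI allI impI, simp,
        rule exI[of _ 1], intro conjI allI impI, simp, elim conjE, rule core) auto
qed

end
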